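(* Let $p>1$ and let $G=(V,E,\mathbf{w},\boldsymbol{\mu})$ be a connected submodular hypergraph with $V=\{1,\dots,N\}$. Let the eigenvalues $\lambda_1^{(p)},\dots,\lambda_N^{(p)}$ of $\triangle_p$ be ordered as $$0=\lambda_1^{(p)}<\lambda_2^{(p)}\le\cdots\le\lambda_{k-1}^{(p)}<\lambda_k^{(p)}=\cdots=\lambda_{k+r-1}^{(p)}<\lambda_{k+r}^{(p)}\le\cdots\le\lambda_N^{(p)},$$ with $\lambda_k^{(p)}$ having multiplicity $r$. Let $x$ be an arbitrary eigenvector associated with $\lambda_k^{(p)}$, i.e. $x\ne0$ and $(\lambda_k^{(p)},x)$ is an eigenpair of $\triangle_p$. Then $x$ induces at most $k+r-1$ strong nodal domains and at most $k$ weak nodal domains.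
   Context: Submodular hypergraph: $V=[N]=\{1,\dots,N\}$; $E\subseteq 2^V$ is a set of hyperedges; each vertex has a weight $\mu_v>0$; each $e\in E$ carries a scalar $\vartheta_e>0$ and a function $w_e:2^e\to[0,1]$ that is submodular ($w_e(S)+w_e(T)\ge w_e(S\cup T)+w_e(S\cap T)$), satisfies $w_e(\emptyset)=0$, is symmetric ($w_e(S)=w_e(e\setminus S)$), and is normalized so that $\max_{S\subseteq e}w_e(S)=1$; every $v\in e$ satisfies $w_e(\{v\})>0$. For $S\subseteq V$ put $w_e(S):=w_e(S\cap e)$ and $\mathrm{vol}(\partial S)=\sum_{e\in E}\vartheta_e w_e(S)$. $G$ is connected if $\mathrm{vol}(\partial S)>0$ for every nonempty $S\subsetneq V$. Lovász extension: $\mathcal{B}_e=\{y\in\mathbb{R}^N: y(S)\le w_e(S)\ \forall S\subseteq V,\ y(V)=0\}$ with $y(S)=\sum_{v\in S}y_v$; $f_e(x)=\max_{y\in\mathcal{B}_e}\langle y,x\rangle$, with subdifferential $\nabla f_e(x)=\arg\max_{y\in\mathcal{B}_e}\langle y,x\rangle$ (a set). $p$-Laplacian for $p>1$ (set-valued): $\triangle_p(x)=\sum_{e\in E}\vartheta_e f_e(x)^{p-1}\nabla f_e(x)$ (Minkowski sum); $Q_p(x)=\sum_{e\in E}\vartheta_e f_e(x)^p$. $U=\mathrm{diag}(\mu_1,\dots,\mu_N)$, $(\varphi_p(x))_v=|x_v|^{p-1}\mathrm{sgn}(x_v)$. A pair $(\lambda,x)$ with $x\neq0$ is an eigenpair of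 $\triangle_p$ if $\lambda U\varphi_p(x)\in\triangle_p(x)$. Variational eigenvalues: $\mathcal{S}_{p,\mu}=\{x\in\mathbb{R}^N:\sum_v\mu_v|x_v|^p=1\}$. For a closed symmetric $A\subset\mathbb{R}^N\setminus\{0\}$ the Krasnoselski genus $\gamma(A)$ is $0$ if $A=\emptyset$, otherwise the least $k\in\mathbb{Z}^+$ such that an odd continuous map $A\to\mathbb{R}^k\setminus\{0\}$ exists ($\infty$ if there is none). $\mathcal{F}_k(\mathcal{S}_{p,\mu})=\{A\subseteq\mathcal{S}_{p,\mu}: A=-A,\ A\text{ closed},\ \gamma(A)\ge k\}$ and $\lambda_k^{(p)}=\min_{A\in\mathcal{F}_k(\mathcal{S}_{p,\mu})}\max_{x\in A}Q_p(x)$, $k=1,\dots,N$. Multiplicity refers to the number of repetitions in this sequence. Nodal domains: for $A\subseteq V$, call $u,v\in A$ adjacent if some $e\in E$ contains both and $w_e(S)>0$ for every $S\subseteq e$ with $u\in S$, $v\notin S$; the connected components of $A$ are those of the resulting graph on $A$. The strong nodal domains of $x\in\mathbb{R}^N$ are the connected components of $\{v:x_v>0\}$ together with the connected components of $\{v:x_v<0\}$. The weak nodal domains of $x$ are the connected components of $\{v:x_v\ge0\}$ together with those of $\{v:x_v\le0\}$. *)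

theory Defs
  imports "HOL-Analysis.Analysis" "HOL-Library.Set_Algebras" "HOL-Library.Extended_Nat"
begin

text \<open>
  The vertex set \<open>{1, \<dots>, N}\<close> is a finite type \<open>'n\<close>, so that \<open>N = CARD('n)\<close> and
  vectors live in \<open>real ^ 'n\<close>.  A hypergraph is given by its hyperedges \<open>E\<close>, the scalars
  \<open>\<theta> e\<close>, the functions \<open>w e\<close> and the vertex weights \<open>\<mu> v\<close>.
  The values of \<open>w e\<close> matter only on subsets of \<open>e\<close>.
\<close>

locale submodular_hypergraph =
  fixes E :: "'n::finite set set"
    and \<theta> :: "'n set \<Rightarrow> real"
    and w :: "'n set \<Rightarrow> 'n set \<Rightarrow> real"
    and \<mu> :: "'n \<Rightarrow> real"
  assumes vertex_weight_pos: "\<mu> v > 0"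
    and scale_pos: "e \<in> E \<Longrightarrow> \<theta> e > 0"
    and w_range: "e \<in> E \<Longrightarrow> S \<subseteq> e \<Longrightarrow> w e S \<in> {0..1}"
    and w_submodular:
      "e \<in> E \<Longrightarrow> S \<subseteq> e \<Longrightarrow> T \<subseteq> e \<Longrightarrow> w e S + w e T \<ge> w e (S \<union> T) + w e (S \<inter> T)"
    and w_empty: "e \<in> E \<Longrightarrow> w e {} = 0"
    and w_symmetric: "e \<in> E \<Longrightarrow> S \<subseteq> e \<Longrightarrow> w e S = w e (e - S)"
    and w_normalized: "e \<in> E \<Longrightarrow> Max (w e ` Pow e) = 1"
    and w_singleton_pos: "e \<in> E \<Longrightarrow> v \<in> e \<Longrightarrow> w e {v} > 0"

definition vol_boundary ::
    "'n::finite set set \<Rightarrow> ('n set \<Rightarrow> real) \<Rightarrow> ('n set \<Rightarrow> 'n set \<Rightarrow> real) \<Rightarrow> 'n set \<Rightarrow> real" where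
  "vol_boundary E \<theta> w S = (\<Sum>e\<in>E. \<theta> e * w e (S \<inter> e))"

definition connected_hypergraph ::
    "'n::finite set set \<Rightarrow> ('n set \<Rightarrow> real) \<Rightarrow> ('n set \<Rightarrow> 'n set \<Rightarrow> real) \<Rightarrow> bool" where
  "connected_hypergraph E \<theta> w \<longleftrightarrow> (\<forall>S. S \<noteq> {} \<and> S \<subset> UNIV \<longrightarrow> vol_boundary E \<theta> w S > 0)"

definition base_polytope ::
    "('n::finite set \<Rightarrow> 'n set \<Rightarrow> real) \<Rightarrow> 'n set \<Rightarrow> (real ^ 'n) set" where
  "base_polytope w e =
     {y. (\<forall>S. (\<Sum>v\<in>S. y $ v) \<le> w e (S \<inter> e)) \<and> (\<Sum>v\<in>UNIV. y $ v) = 0}"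

text \<open>The base polytope of a hyperedge is compact and contains \<open>0\<close>, so this supremum is a maximum.\<close>

definition lovasz_ext ::
    "('n::finite set \<Rightarrow> 'n set \<Rightarrow> real) \<Rightarrow> 'n set \<Rightarrow> real ^ 'n \<Rightarrow> real" where
  "lovasz_ext w e x = (SUP y\<in>base_polytope w e. y \<bullet> x)"

definition lovasz_subdiff ::
    "('n::finite set \<Rightarrow> 'n set \<Rightarrow> real) \<Rightarrow> 'n set \<Rightarrow> real ^ 'n \<Rightarrow> (real ^ 'n) set" where
  "lovasz_subdiff w e x = {y. is_arg_max (\<lambda>y. y \<bullet> x) (\<lambda>y. y \<in> base_polytope w e) y}"

text \<open>The outer sum is the Minkowski sum of sets from \<open>Set_Algebras\<close>.\<close>

definition p_laplacian ::
    "'n::finite set set \<Rightarrow> ('n set \<Rightarrow> real) \<Rightarrow> ('n set \<Rightarrow> 'n set \<Rightarrow> real) \<Rightarrow> real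
      \<Rightarrow> real ^ 'n \<Rightarrow> (real ^ 'n) set" where
  "p_laplacian E \<theta> w p x =
     (\<Sum>e\<in>E. (\<lambda>y. (\<theta> e * lovasz_ext w e x powr (p - 1)) *\<^sub>R y) ` lovasz_subdiff w e x)"

definition Q_form ::
    "'n::finite set set \<Rightarrow> ('n set \<Rightarrow> real) \<Rightarrow> ('n set \<Rightarrow> 'n set \<Rightarrow> real) \<Rightarrow> real
      \<Rightarrow> real ^ 'n \<Rightarrow> real" where
  "Q_form E \<theta> w p x = (\<Sum>e\<in>E. \<theta> e * lovasz_ext w e x powr p)"

definition phi :: "real \<Rightarrow> real ^ 'n \<Rightarrow> real ^ 'n" where
  "phi p x = (\<chi> v. \<bar>x $ v\<bar> powr (p - 1) * sgn (x $ v))"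

definition diag_mat :: "('n \<Rightarrow> real) \<Rightarrow> real ^ 'n ^ 'n" where
  "diag_mat \<mu> = (\<chi> u v. if u = v then \<mu> v else 0)"

definition eigenpair ::
    "'n::finite set set \<Rightarrow> ('n set \<Rightarrow> real) \<Rightarrow> ('n set \<Rightarrow> 'n set \<Rightarrow> real) \<Rightarrow> ('n \<Rightarrow> real) \<Rightarrow> real
      \<Rightarrow> real \<Rightarrow> real ^ 'n \<Rightarrow> bool" where
  "eigenpair E \<theta> w \<mu> p l x \<longleftrightarrow>
     x \<noteq> 0 \<and> l *\<^sub>R (diag_mat \<mu> *v phi p x) \<in> p_laplacian E \<theta> w p x"

definition p_sphere :: "('n::finite \<Rightarrow> real) \<Rightarrow> real \<Rightarrow> (real ^ 'n) set" where
  "p_sphere \<mu> p = {x. (\<Sum>v\<in>UNIV. \<mu> v * \<bar>x $ v\<bar> powr p) = 1}"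

text \<open>
  \<open>Euclidean_space k\<close> is the library's $\mathbb{R}^k$ for a term-level \<open>k\<close>: sequences
  \<open>nat \<Rightarrow> real\<close> vanishing from index \<open>k\<close> on.
\<close>

definition odd_map_exists :: "'a::real_normed_vector set \<Rightarrow> nat \<Rightarrow> bool" where
  "odd_map_exists A k \<longleftrightarrow>
     (\<exists>g. continuous_map (top_of_set A) (subtopology (Euclidean_space k) (- {\<lambda>i. 0})) g \<and>
          (\<forall>x\<in>A. g (- x) = (\<lambda>i. - g x i)))"

text \<open>An infimum over the empty set of extended naturals is \<open>\<infinity>\<close>.\<close>

definition genus :: "'a::real_normed_vector set \<Rightarrow> enat" where
  "genus A = (if A = {} then 0 else (INF k\<in>{k. k \<ge> 1 \<and> odd_map_exists A k}. enat k))"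

definition genus_family ::
    "('n::finite \<Rightarrow> real) \<Rightarrow> real \<Rightarrow> nat \<Rightarrow> (real ^ 'n) set set" where
  "genus_family \<mu> p k = {A. A \<subseteq> p_sphere \<mu> p \<and> uminus ` A = A \<and> closed A \<and> genus A \<ge> enat k}"

text \<open>
  For \<open>p > 1\<close> and \<open>1 \<le> k \<le> CARD('n)\<close> the infimum and the suprema are the minimum and the maxima
  of the usual min-max formula: \<open>genus_family\<close> is nonempty, its members are nonempty and compact,
  and \<open>Q_form\<close> is continuous and nonnegative.
\<close>

definition var_eigenvalue ::
    "'n::finite set set \<Rightarrow> ('n set \<Rightarrow> real) \<Rightarrow> ('n set \<Rightarrow> 'n set \<Rightarrow> real) \<Rightarrow> ('n \<Rightarrow> real) \<Rightarrow> real
      \<Rightarrow> nat \<Rightarrow> real" where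
  "var_eigenvalue E \<theta> w \<mu> p k = (INF A\<in>genus_family \<mu> p k. SUP x\<in>A. Q_form E \<theta> w p x)"

definition adjacency ::
    "'n::finite set set \<Rightarrow> ('n set \<Rightarrow> 'n set \<Rightarrow> real) \<Rightarrow> 'n rel" where
  "adjacency E w =
     {(u, v). \<exists>e\<in>E. u \<in> e \<and> v \<in> e \<and> (\<forall>S\<subseteq>e. u \<in> S \<and> v \<notin> S \<longrightarrow> w e S > 0)}"

text \<open>
  Adjacency is symmetric because each \<open>w e\<close> is, so reachability inside \<open>A\<close> is an equivalence
  relation on \<open>A\<close>.
\<close>

definition conn_components ::
    "'n::finite set set \<Rightarrow> ('n set \<Rightarrow> 'n set \<Rightarrow> real) \<Rightarrow> 'n set \<Rightarrow> 'n set set" where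
  "conn_components E w A = A // (Restr (adjacency E w) A)\<^sup>*"

definition strong_nodal_domains ::
    "'n::finite set set \<Rightarrow> ('n set \<Rightarrow> 'n set \<Rightarrow> real) \<Rightarrow> real ^ 'n \<Rightarrow> 'n set set" where
  "strong_nodal_domains E w x =
     conn_components E w {v. x $ v > 0} \<union> conn_components E w {v. x $ v < 0}"

definition weak_nodal_domains ::
    "'n::finite set set \<Rightarrow> ('n set \<Rightarrow> 'n set \<Rightarrow> real) \<Rightarrow> real ^ 'n \<Rightarrow> 'n set set" where
  "weak_nodal_domains E w x =
     conn_components E w {v. x $ v \<ge> 0} \<union> conn_components E w {v. x $ v \<le> 0}"

end

theory Submission
  imports Defs "HOL-Homology.Invariance_of_Domain"
begin

text \<open>
  Let \<open>u\<close> maximize \<open>\<langle>y, x\<rangle>\<close> over the base polytope of a hyperedge \<open>e\<close>.  Then \<open>u\<close> is tight on every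
  superlevel set of \<open>x\<close>, and tightness survives intersection with a nodal domain because distinct
  domains are separated by zero sets of \<open>w e\<close>.  Hence \<open>u\<close> is also a maximizer for the restriction of
  \<open>x\<close> to each nodal domain, and the power mean inequality gives
  \<open>Q(y) \<le> \<lambda> \<parallel>y\<parallel>^p\<close> on the span of these restrictions.  By the Borsuk--Ulam theorem the unit sphere of
  the span of \<open>m\<close> restrictions has genus at least \<open>m\<close>, which bounds the number of strong domains.

  For weak domains, drop one domain and suppose that \<open>k\<close> others remain.  On the sphere of their span, a
  point with \<open>Q(y) = \<lambda>\<close> admits a first-order descent direction, supported on zeros of \<open>x\<close> shared by a
  domain that occurs in \<open>y\<close> and one that does not.  Gluing these directions by an odd partition of unity
  pushes the sphere into \<open>{Q < \<lambda>}\<close>, which contradicts the definition of \<open>\<lambda> = \<lambda>\<^sub>k\<close> as an infimum.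
\<close>

section \<open>The Borsuk--Ulam theorem\<close>

text \<open>The energy is convex but not differentiable, and its difference with
  \<open>l * mass\<close> is in general not convex either, so no gradient flow is at hand to deform
  a sphere below the level \<open>\<lambda>\<close>. Descent points are averaged instead. This needs
  them to lower a function that is convex in the point, and so a descent point \<open>z\<close> is
  required to keep \<open>pairing y z\<close>, the linearized mass, rather than the mass itself.

  Equality in the power mean inequality is rigid: within one hyperedge all domains on which the
  Lovasz extension is positive carry coefficients of the same modulus. Hence a domain that occurs
  and one that is omitted can touch only at zeros of \<open>x\<close>, which is where the descent
  direction lives. One domain has to be omitted for such a contact to exist: connectedness then
  provides an adjacency that leaves the union of the omitted domains.\<close>

definition coord_proj :: "'a::euclidean_space set \<Rightarrow> 'a \<Rightarrow> 'a" where
  "coord_proj B v = (\<Sum>i\<in>B. (v \<bullet> i) *\<^sub>R i)"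

lemma linear_coord_proj: "linear (coord_proj B)"
  by (auto intro!: linearI simp: coord_proj_def inner_add_left sum.distrib scaleR_add_left scaleR_sum_right)

lemma coord_proj_inner:
  assumes "B \<subseteq> Basis" "j \<in> Basis"
  shows "coord_proj B v \<bullet> j = (if j \<in> B then v \<bullet> j else 0)"
proof -
  have "coord_proj B v \<bullet> j = (\<Sum>i\<in>B. if i = j then v \<bullet> j else 0)"
    unfolding coord_proj_def inner_sum_left
  proof (rule sum.cong[OF refl])
    fix i assume "i \<in> B"
    then have "i \<in> Basis" using assms by blast
    then show "((v \<bullet> i) *\<^sub>R i) \<bullet> j = (if i = j then v \<bullet> j else 0)"
      using assms by (cases "i = j") (simp_all add: inner_Basis)
  qed
  moreover have "finite B"
    by (rule finite_subset[OF assms(1) finite_Basis])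
  ultimately show ?thesis
    by simp
qed

lemma norm_coord_proj_le:
  assumes "B \<subseteq> Basis"
  shows "norm (coord_proj B v) \<le> norm v"
  by (rule norm_le_componentwise) (auto simp: coord_proj_inner assms)

text \<open>Scaling by \<open>c\<close> scales the norm of the projection by the modulus of
  \<open>c\<close>, so each ray from the origin meets the cylinder at most once.\<close>

lemma negligible_cylinder: "negligible {v. norm (coord_proj B v) = 1}"
proof (rule starlike_negligible[where a = 0])
  have "continuous_on UNIV (coord_proj B)"
    by (simp add: linear_continuous_on linear_linear linear_coord_proj)
  then show "closed {v. norm (coord_proj B v) = 1}"
    by (intro closed_Collect_eq continuous_intros)
qed (auto simp: linear_cmul[OF linear_coord_proj])

text \<open>
  The two linear homotopies from \<open>F\<close> through \<open>g\<close> to \<open>G\<close> avoid \<open>0\<close>, and the endpoint maps the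
  equator into itself.  The direction \<open>q\<close> along which \<open>g\<close> is pushed exists because a smooth map
  sends the negligible cylinder over the equator to a negligible set.
\<close>

lemma equatorial_perturbation:
  fixes F :: "'a::euclidean_space \<Rightarrow> 'a"
  assumes B: "B \<subseteq> Basis" and b: "b \<in> Basis" "b \<notin> B"
    and E_def: "E = {v. \<forall>j\<in>Basis - insert b B. v \<bullet> j = 0}"
    and F: "continuous_on (sphere 0 1 \<inter> E) F" "F ` (sphere 0 1 \<inter> E) \<subseteq> sphere 0 1 \<inter> E"
    and odd: "\<forall>x\<in>sphere 0 1 \<inter> E. F (- x) = - F x"
  shows "\<exists>g G. continuous_on UNIV g \<and> continuous_on UNIV G \<and>
    (\<forall>x. g (- x) = - g x) \<and> (\<forall>x. G (- x) = - G x) \<and> range g \<subseteq> E \<and> range G \<subseteq> E \<and>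
    (\<forall>x\<in>sphere 0 1 \<inter> E. norm (F x - g x) < 1) \<and>
    (\<forall>x\<in>sphere 0 1 \<inter> E. \<forall>t\<in>{0..1}. (1 - t) *\<^sub>R g x + t *\<^sub>R G x \<noteq> 0) \<and>
    (\<forall>x. x \<bullet> b = 0 \<longrightarrow> G x \<bullet> b = 0)"
proof -
  let ?S = "sphere 0 1 \<inter> E"
  let ?B = "insert b B"
  have BB: "?B \<subseteq> Basis" using B b by auto
  have "closed E"
    unfolding E_def Ball_def by (intro closed_Collect_all closed_Collect_imp open_Collect_const closed_Collect_eq continuous_intros)
  then have "compact ?S" by (simp add: compact_Int_closed)
  from Stone_Weierstrass_polynomial_function[OF this F(1) zero_less_one]
  obtain h where h: "polynomial_function h" "\<And>x. x \<in> ?S \<Longrightarrow> norm (F x - h x) < 1" by blast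
  \<comment> \<open>The odd part of the polynomial approximation, projected back to
    \<open>E\<close>. Projecting does not increase distances, so \<open>g\<close> stays within 1 of
    \<open>F\<close>; its differentiability is what the negligibility argument needs.\<close>
  define g where "g x = coord_proj ?B ((1/2) *\<^sub>R (h x - h (- x)))" for x
  have Eneg: "- x \<in> ?S" if "x \<in> ?S" for x using that by (auto simp: E_def)
  have PE: "coord_proj ?B v \<in> E" for v
    by (simp add: E_def coord_proj_inner[OF BB])
  have PEid: "coord_proj ?B v = v" if "v \<in> E" for v
  proof (rule euclidean_eqI)
    show "coord_proj ?B v \<bullet> j = v \<bullet> j" if "j \<in> Basis" for j
      using that \<open>v \<in> E\<close> unfolding coord_proj_inner[OF BB that] E_def by auto
  qed
  have gE: "g x \<in> E" for x unfolding g_def by (rule PE)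
  have h_neg: "polynomial_function (\<lambda>x. h (- x))"
    using polynomial_function_compose[OF polynomial_function_minus[OF polynomial_function_id] h(1)]
    by (simp add: o_def)
  have poly: "polynomial_function (\<lambda>x. (1/2) *\<^sub>R (h x - h (- x)))"
    by (intro polynomial_function_mult polynomial_function_diff h h_neg polynomial_function_const)
  have diff: "g differentiable_on X" for X
    unfolding g_def
    by (intro differentiable_on_compose[of "\<lambda>x. (1/2) *\<^sub>R (h x - h (- x))" X "coord_proj ?B", unfolded o_def]
        differentiable_on_polynomial_function[OF poly] linear_imp_differentiable_on linear_coord_proj)
  then have gc: "continuous_on X g" for X
    by (rule differentiable_imp_continuous_on)
  have godd: "g (- x) = - g x" for x
    unfolding g_def by (simp flip: linear_neg[OF linear_coord_proj] add: scaleR_diff_right)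
  have gF: "norm (F x - g x) < 1" if x: "x \<in> ?S" for x
  proof -
    have "F x - g x = coord_proj ?B ((1/2) *\<^sub>R ((F x - h x) - (F (- x) - h (- x))))"
    proof -
      have "F x = coord_proj ?B (F x)" using F(2) x PEid by (auto simp: image_subset_iff)
      moreover have "coord_proj ?B (F x) - g x = coord_proj ?B (F x - (1/2) *\<^sub>R (h x - h (- x)))"
        unfolding g_def by (simp add: linear_diff[OF linear_coord_proj])
      moreover have "F x - (1/2) *\<^sub>R (h x - h (- x)) = (1/2) *\<^sub>R ((F x - h x) - (F (- x) - h (- x)))"
        using bspec[OF odd x] by (simp add: algebra_simps flip: scaleR_add_left)
      ultimately show ?thesis by simp
    qed
    also have "norm \<dots> \<le> norm ((1/2) *\<^sub>R ((F x - h x) - (F (- x) - h (- x))))"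
      by (rule norm_coord_proj_le[OF BB])
    also have "\<dots> \<le> (norm (F x - h x) + norm (F (- x) - h (- x))) / 2"
      by (simp add: norm_triangle_ineq4)
    also have "\<dots> < 1"
      using h(2)[OF x] h(2)[OF Eneg[OF x]] by simp
    finally show ?thesis .
  qed
  have g0: "g x \<noteq> 0" if "x \<in> ?S" for x
    using gF[OF that] F(2) that by (auto simp: image_subset_iff)
  \<comment> \<open>The coordinates of \<open>v\<close> in \<open>B\<close> give a point of the
    equator, the one along \<open>b\<close> gives a scalar \<open>s\<close>, and the remaining ones
    are copied. Copying makes source and target the same space, so that a differentiable map
    preserves negligibility. If \<open>q\<close> is not in the image of the cylinder, its projection
    \<open>q0\<close> is never of the form \<open>s *\<^sub>R g x\<close> with \<open>x\<close> on
    the equator.\<close>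
  define \<Psi> where "\<Psi> v = (v \<bullet> b) *\<^sub>R g (coord_proj B v) + (v - coord_proj ?B v)" for v
  have lin_diff: "coord_proj C differentiable_on X" for C :: "'a set" and X
    by (intro linear_imp_differentiable_on linear_coord_proj)
  have "\<Psi> differentiable_on X" for X
    unfolding \<Psi>_def
    by (intro differentiable_on_add differentiable_on_scaleR differentiable_on_diff lin_diff
        differentiable_on_compose[of "coord_proj B" X g, unfolded o_def] diff differentiable_on_ident
        bounded_linear_imp_differentiable_on[OF bounded_linear_inner_left])
  then have "negligible (\<Psi> ` {v. norm (coord_proj B v) = 1})"
    by (intro negligible_differentiable_image_negligible negligible_cylinder) auto
  moreover have "negligible {v. v \<bullet> b = 0}"
    using b by blast
  ultimately have "negligible (\<Psi> ` {v. norm (coord_proj B v) = 1} \<union> {v. v \<bullet> b = 0})"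
    by (rule negligible_Un)
  then have "\<Psi> ` {v. norm (coord_proj B v) = 1} \<union> {v. v \<bullet> b = 0} \<noteq> UNIV"
    using non_negligible_UNIV by metis
  then obtain q where q: "q \<notin> \<Psi> ` {v. norm (coord_proj B v) = 1}" "q \<bullet> b \<noteq> 0" by blast
  define q0 where "q0 = coord_proj ?B q"
  have q0b: "q0 \<bullet> b = q \<bullet> b" unfolding q0_def using BB b by (simp add: coord_proj_inner)
  have miss: "s *\<^sub>R g x \<noteq> q0" if x: "x \<in> ?S" "x \<bullet> b = 0" for x s
  proof
    assume eq: "s *\<^sub>R g x = q0"
    define v where "v = x + s *\<^sub>R b + (q - q0)"
    have vj: "v \<bullet> j = x \<bullet> j + s * (b \<bullet> j) + (if j \<in> ?B then 0 else q \<bullet> j)" if "j \<in> Basis" for j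
      unfolding v_def q0_def inner_add_left inner_diff_left inner_scaleR_left
        coord_proj_inner[OF BB that] by simp
    have xj: "x \<bullet> j = 0" if "j \<in> Basis" "j \<notin> B" for j
      using that x by (cases "j = b") (auto simp: E_def)
    have bj: "b \<bullet> j = (if j = b then 1 else 0)" if "j \<in> Basis" for j
      using that b by (simp add: inner_Basis)
    have "coord_proj B v = x"
    proof (rule euclidean_eqI)
      show "coord_proj B v \<bullet> j = x \<bullet> j" if "j \<in> Basis" for j
        unfolding coord_proj_inner[OF B that] vj[OF that] bj[OF that] using xj[OF that] b(2) by auto
    qed
    moreover have "v \<bullet> b = s"
      using b x q0b by (simp add: v_def inner_add_left inner_diff_left)
    moreover have "v - coord_proj ?B v = q - q0"
    proof (rule euclidean_eqI)
      show "(v - coord_proj ?B v) \<bullet> j = (q - q0) \<bullet> j" if "j \<in> Basis" for j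
        unfolding q0_def inner_diff_left coord_proj_inner[OF BB that] vj[OF that] bj[OF that]
        using xj[OF that] by auto
    qed
    ultimately have "\<Psi> v = q" "norm (coord_proj B v) = 1"
      using eq x by (auto simp: \<Psi>_def)
    then show False using q by blast
  qed
  define c where "c x = (g x \<bullet> b) / (q \<bullet> b)" for x
  \<comment> \<open>On the equator the factor is \<open>c x\<close>, which removes exactly the
    \<open>b\<close>-coordinate of \<open>g x\<close>. The modulus keeps the factor in front of
    \<open>c\<close> even, and \<open>c\<close> is odd, so \<open>G\<close> is odd.\<close>
  define G where "G x = g x - ((1 - \<bar>x \<bullet> b\<bar>) * c x) *\<^sub>R q0" for x
  show ?thesis
  proof (rule exI[of _ g], rule exI[of _ G], intro conjI allI ballI impI)
    show "continuous_on UNIV g" by (rule gc)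
    show "continuous_on UNIV G"
      unfolding G_def c_def using q by (intro continuous_intros gc) auto
    show "g (- x) = - g x" for x by (rule godd)
    show "G (- x) = - G x" for x by (simp add: G_def c_def godd)
    show "range g \<subseteq> E" using gE by auto
    have "G x \<in> E" for x
      using gE[of x] PE[of q] unfolding G_def q0_def[symmetric] by (auto simp: E_def inner_diff_left)
    then show "range G \<subseteq> E" by auto
    show "norm (F x - g x) < 1" if "x \<in> ?S" for x using that by (rule gF)
    show "G x \<bullet> b = 0" if "x \<bullet> b = 0" for x
      using that q q0b by (simp add: G_def c_def inner_diff_left)
    show "(1 - t) *\<^sub>R g x + t *\<^sub>R G x \<noteq> 0" if x: "x \<in> ?S" and t: "t \<in> {0..1}" for x t
    proof
      assume "(1 - t) *\<^sub>R g x + t *\<^sub>R G x = 0"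
      \<comment> \<open>A zero of the homotopy makes \<open>g x\<close> a multiple of
        \<open>q0\<close>. Comparing \<open>b\<close>-coordinates then forces
        \<open>t * (1 - \<bar>x \<bullet> b\<bar>) = 1\<close>, hence \<open>t = 1\<close> with
        \<open>x\<close> on the equator, and this is the case that the choice of \<open>q\<close>
        excludes.\<close>
      then have *: "g x = (t * (1 - \<bar>x \<bullet> b\<bar>) * c x) *\<^sub>R q0"
        by (simp add: G_def algebra_simps)
      then have "g x \<bullet> b = t * (1 - \<bar>x \<bullet> b\<bar>) * c x * (q \<bullet> b)"
        using q0b by (metis inner_scaleR_left)
      then have "c x = t * (1 - \<bar>x \<bullet> b\<bar>) * c x"
        using q by (simp add: c_def)
      moreover have c0: "c x \<noteq> 0"
        using * g0[OF x] by auto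
      ultimately have "t * (1 - \<bar>x \<bullet> b\<bar>) = 1" by simp
      moreover have "\<bar>x \<bullet> b\<bar> \<le> 1" using x b by (metis Basis_le_norm IntE mem_sphere_0)
      then have "t * (1 - \<bar>x \<bullet> b\<bar>) \<le> 1 - \<bar>x \<bullet> b\<bar>"
        using t mult_right_mono[of t 1 "1 - \<bar>x \<bullet> b\<bar>"] by simp
      ultimately have xb: "x \<bullet> b = 0" and t1: "t = 1" by auto
      have "inverse (c x) *\<^sub>R g x = q0"
        using * xb t1 c0 by simp
      then show False using miss[OF x xb] by blast
    qed
  qed
qed

section \<open>Spheres in coordinates and the degree of odd maps\<close>

lemma nsphere_top_of_set:
  "nsphere n = top_of_set {x. (\<Sum>i\<le>n. (x i)\<^sup>2) = 1 \<and> (\<forall>i>n. x i = 0)}"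
  by (simp add: nsphere euclidean_product_topology)

lemma topspace_nsphere: "topspace (nsphere n) = {x. (\<Sum>i\<le>n. (x i)\<^sup>2) = 1 \<and> (\<forall>i>n. x i = 0)}"
  by (simp add: nsphere_top_of_set)

lemma nsphere_eq_top_of_set_topspace: "nsphere n = top_of_set (topspace (nsphere n))"
  by (simp add: nsphere_top_of_set)

lemma topspace_nsphere_mono: "m \<le> n \<Longrightarrow> topspace (nsphere m) \<subseteq> topspace (nsphere n)"
proof
  fix x :: "nat \<Rightarrow> real" assume "m \<le> n" "x \<in> topspace (nsphere m)"
  moreover from this have "(\<Sum>i\<le>n. (x i)\<^sup>2) = (\<Sum>i\<le>m. (x i)\<^sup>2)"
    by (intro sum.mono_neutral_right) (auto simp: topspace_nsphere)
  ultimately show "x \<in> topspace (nsphere n)"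
    by (auto simp: topspace_nsphere)
qed

text \<open>Induction on the dimension. For an odd map that preserves the equator the degree has the
  same parity as that of the restriction, and \<open>equatorial_perturbation\<close> deforms every
  odd map into one of this kind. The space \<open>'a\<close> hosts all spheres up to dimension
  \<open>n\<close> in its coordinate subspaces \<open>E k\<close>: polynomial approximation and
  negligibility take place there, and an induction cannot change the type.\<close>

theorem odd_Brouwer_degree2:
  assumes "n < DIM('a::euclidean_space)"
    and "continuous_map (nsphere n) (nsphere n) f"
    and "\<And>x. x \<in> topspace (nsphere n) \<Longrightarrow> f (\<lambda>i. - x i) = (\<lambda>i. - f x i)"
  shows "odd (Brouwer_degree2 n f)"
proof -
  let ?D = "DIM('a)"
  let ?S = "\<lambda>n. topspace (nsphere n)"
  obtain b :: "nat \<Rightarrow> 'a" where bij: "bij_betw b {..<?D} Basis"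
    using ex_bij_betw_nat_finite[OF finite_Basis] by (auto simp: atLeast0LessThan)
  have bB: "b i \<in> Basis" if "i < ?D" for i
    using bij that by (auto simp: bij_betw_def)
  have bb: "b i \<bullet> b j = (if i = j then 1 else 0)" if "i < ?D" "j < ?D" for i j
    using bij that inner_Basis[OF bB bB, OF that] by (auto simp: bij_betw_def inj_on_def)
  define to where "to x = (\<Sum>i<?D. x i *\<^sub>R b i)" for x :: "nat \<Rightarrow> real"
  define fr where "fr v = (\<lambda>i. if i < ?D then v \<bullet> b i else 0)" for v :: 'a
  define E where "E n = {v. \<forall>j\<in>Basis - b ` {..n}. v \<bullet> j = 0}" for n
  have E_iff: "v \<in> E n \<longleftrightarrow> (\<forall>i<?D. n < i \<longrightarrow> v \<bullet> b i = 0)" if "n < ?D" for v n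
  proof -
    have "Basis - b ` {..n} = b ` ({..<?D} - {..n})"
    proof -
      have "{..<?D} - {..n} \<subseteq> {..<?D}" "{..n} \<subseteq> {..<?D}" using that by auto
      then show ?thesis
        using bij inj_on_image_set_diff[of b "{..<?D}" "{..<?D}" "{..n}"]
        by (simp add: bij_betw_def)
    qed
    then show ?thesis by (auto simp: E_def)
  qed
  have to_b: "to x \<bullet> b i = x i" if "i < ?D" for x i
  proof -
    have "to x \<bullet> b i = (\<Sum>j<?D. if j = i then x i else 0)"
      unfolding to_def inner_sum_left by (intro sum.cong) (auto simp: bb that)
    then show ?thesis using that by simp
  qed
  have to_fr: "to (fr v) = v" for v
  proof -
    have "to (fr v) = (\<Sum>i<?D. (v \<bullet> b i) *\<^sub>R b i)" by (simp add: to_def fr_def)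
    also have "\<dots> = (\<Sum>i\<in>Basis. (v \<bullet> i) *\<^sub>R i)"
      by (rule sum.reindex_bij_betw[OF bij, of "\<lambda>i. (v \<bullet> i) *\<^sub>R i"])
    finally show ?thesis by (simp add: euclidean_representation)
  qed
  have norm_v: "(norm v)\<^sup>2 = (\<Sum>i<?D. (v \<bullet> b i)\<^sup>2)" for v
    unfolding sum.reindex_bij_betw[OF bij, of "\<lambda>i. (v \<bullet> i)\<^sup>2"]
    unfolding power2_norm_eq_inner by (subst euclidean_inner) (simp add: power2_eq_square)
  have norm_E: "(norm v)\<^sup>2 = (\<Sum>i\<le>n. (v \<bullet> b i)\<^sup>2)" if "n < ?D" "v \<in> E n" for v n
    unfolding norm_v using that by (intro sum.mono_neutral_right) (auto simp: E_iff)
  have fr_to: "fr (to x) = x" if "n < ?D" "x \<in> ?S n" for x n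
    using that by (auto simp: fr_def to_b topspace_nsphere fun_eq_iff)
  have to_in: "to x \<in> sphere 0 1 \<inter> E n" if "n < ?D" "x \<in> ?S n" for x n
  proof -
    have 1: "to x \<in> E n" using that by (auto simp: E_iff to_b topspace_nsphere)
    have "(norm (to x))\<^sup>2 = (\<Sum>i\<le>n. (x i)\<^sup>2)"
      unfolding norm_E[OF that(1) 1] using that by (intro sum.cong) (auto simp: to_b)
    also have "\<dots> = 1" using that by (simp add: topspace_nsphere)
    finally show ?thesis using 1 by (simp add: power2_eq_1_iff)
      (smt (verit) norm_ge_zero)
  qed
  have fr_in: "fr v \<in> ?S n" if "n < ?D" "v \<in> sphere 0 1 \<inter> E n" for v n
    using that norm_E[of n v] by (auto simp: topspace_nsphere fr_def E_iff)
  have to_neg: "to (\<lambda>i. - x i) = - to x" for x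
    by (simp add: to_def sum_negf)
  have fr_neg: "fr (- v) = (\<lambda>i. - fr v i)" for v
    by (simp add: fr_def fun_eq_iff)
  have E_scale: "a *\<^sub>R u + c *\<^sub>R v \<in> E n" if "u \<in> E n" "v \<in> E n" for u v a c n
    using that by (auto simp: E_def inner_add_left)
  have sgn_in: "sgn v \<in> sphere 0 1 \<inter> E n" if "v \<in> E n" "v \<noteq> 0" for v n
    using that by (auto simp: norm_sgn sgn_div_norm E_def)
  have cont_to: "continuous_on X to" for X
    unfolding to_def
    by (intro continuous_intros continuous_on_subset[OF continuous_on_product_coordinates]) auto
  have cont_fr: "continuous_on X fr" for X
  proof (rule continuous_on_coordinatewise_then_product)
    show "continuous_on X (\<lambda>v. fr v i)" for i
      by (cases "i < ?D") (auto simp: fr_def intro!: continuous_intros)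
  qed
  have cont_sgn: "continuous_on X (\<lambda>x. sgn (h x))" if "continuous_on X h" "\<And>x. x \<in> X \<Longrightarrow> h x \<noteq> 0"
    for X and h :: "'b::topological_space \<Rightarrow> 'a"
    unfolding sgn_div_norm using that by (intro continuous_intros) auto
  define nrm where "nrm F x = fr (sgn (F (to x)))" for F x
  have homotopic: "homotopic_with (\<lambda>_. True) (nsphere n) (nsphere n) (nrm F) (nrm G)"
    if n: "n < ?D"
      and F: "continuous_on (sphere 0 1 \<inter> E n) F" "F ` (sphere 0 1 \<inter> E n) \<subseteq> E n"
      and G: "continuous_on (sphere 0 1 \<inter> E n) G" "G ` (sphere 0 1 \<inter> E n) \<subseteq> E n"
      and ne: "\<And>x t. x \<in> sphere 0 1 \<inter> E n \<Longrightarrow> t \<in> {0..1} \<Longrightarrow> (1 - t) *\<^sub>R F x + t *\<^sub>R G x \<noteq> 0"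
    for n F G
  proof -
    let ?h = "\<lambda>(t, x). fr (sgn ((1 - t) *\<^sub>R F (to x) + t *\<^sub>R G (to x)))"
    have csnd: "continuous_on ({0..1::real} \<times> ?S n) (\<lambda>z. to (snd z))"
      by (rule continuous_on_compose2[OF cont_to[of UNIV] continuous_on_snd[OF continuous_on_id]]) simp
    have snd_in: "(\<lambda>z. to (snd z)) ` ({0..1::real} \<times> ?S n) \<subseteq> sphere 0 1 \<inter> E n"
      using to_in[OF n] by (simp add: image_subset_iff)
    have cF: "continuous_on ({0..1::real} \<times> ?S n) (\<lambda>z. F (to (snd z)))"
      by (rule continuous_on_compose2[OF F(1) csnd snd_in])
    have cG: "continuous_on ({0..1::real} \<times> ?S n) (\<lambda>z. G (to (snd z)))"
      by (rule continuous_on_compose2[OF G(1) csnd snd_in])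
    have cont: "continuous_on ({0..1::real} \<times> ?S n) ?h"
      unfolding case_prod_beta
      by (intro continuous_on_compose2[OF cont_fr[of UNIV]] cont_sgn continuous_intros cF cG ne)
        (use to_in[OF n] in auto)
    have into: "?h z \<in> ?S n" if "z \<in> {0..1} \<times> ?S n" for z
    proof -
      have "F (to (snd z)) \<in> E n" "G (to (snd z)) \<in> E n"
        using that F(2) G(2) to_in[OF n, of "snd z"] by auto
      then show ?thesis
        unfolding case_prod_beta using that ne[OF to_in[OF n], of "snd z" "fst z"]
        by (intro fr_in[OF n] sgn_in E_scale) auto
    qed
    have "continuous_map (top_of_set ({0..1} \<times> ?S n)) (top_of_set (?S n)) ?h"
      using cont into by (simp add: image_subset_iff_funcset)
    then have "continuous_map (prod_topology (top_of_set {0..1}) (nsphere n)) (nsphere n) ?h"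
      by (simp add: nsphere_top_of_set)
    then show ?thesis
      unfolding homotopic_with_def by (intro exI[of _ ?h]) (simp add: nrm_def)
  qed
  show ?thesis
    using assms
  proof (induction n arbitrary: f)
    case 0
    \<comment> \<open>On the two points of the 0-sphere \<open>f\<close> fixes a point or negates
      it; in both cases oddness makes \<open>f \<circ> f\<close> the identity, so the degree squares
      to 1.\<close>
    have "f (f x) = x" if x: "x \<in> ?S 0" for x
    proof -
      have fx: "f x \<in> ?S 0"
        using continuous_map_image_subset_topspace[OF 0(2)] x by blast
      then have *: "(f x 0)\<^sup>2 = (x 0)\<^sup>2" "\<forall>i>0. f x i = 0" "\<forall>i>0. x i = 0"
        using x by (auto simp: topspace_nsphere)
      then consider "f x 0 = x 0" | "f x 0 = - x 0"
        by (meson power2_eq_iff)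
      then have "f x = x \<or> f x = (\<lambda>i. - x i)"
      proof cases
        case 1
        have "f x i = x i" for i
          using 1 *(2,3) by (cases "i = 0") auto
        then show ?thesis by blast
      next
        case 2
        have "f x i = - x i" for i
          using 2 *(2,3) by (cases "i = 0") auto
        then show ?thesis by blast
      qed
      then show ?thesis
        using 0(3)[OF x] by auto
    qed
    then have "Brouwer_degree2 0 (f \<circ> f) = Brouwer_degree2 0 id"
      by (intro Brouwer_degree2_eq) auto
    then have "Brouwer_degree2 0 f * Brouwer_degree2 0 f = 1"
      using Brouwer_degree2_compose[OF 0(2) 0(2)] by simp
    then show ?case
      by (metis even_mult_iff odd_one)
  next
    case (Suc k)
    let ?n = "Suc k"
    let ?SE = "sphere 0 1 \<inter> E ?n"
    note n = Suc.prems(1)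
    have k: "k < ?D" using n by simp
    have fS: "f x \<in> ?S ?n" if "x \<in> ?S ?n" for x
      using continuous_map_image_subset_topspace[OF Suc.prems(2)] that by blast
    define F where "F v = to (f (fr v))" for v
    have cf: "continuous_on (?S ?n) f"
      using Suc.prems(2) by (simp add: nsphere_top_of_set)
    have contF: "continuous_on ?SE F"
      unfolding F_def
      by (rule continuous_on_compose2[OF cont_to[of UNIV] continuous_on_compose2[OF cf cont_fr]])
        (use fr_in[OF n] in auto)
    have F_in: "F ` ?SE \<subseteq> ?SE"
      using to_in[OF n fS[OF fr_in[OF n]]] by (auto simp: F_def)
    have F_odd: "\<forall>v\<in>?SE. F (- v) = - F v"
      using Suc.prems(3)[OF fr_in[OF n]] by (simp add: F_def fr_neg to_neg)
    have "b i \<noteq> b ?n" if "i \<le> k" for i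
      using that n bb[of i ?n] bb[of ?n ?n] by auto
    then have bn: "b ?n \<in> Basis" "b ?n \<notin> b ` {..k}"
      using bB[OF n] by (auto simp: eq_commute[of "b ?n"])
    have B: "b ` {..k} \<subseteq> Basis"
      using n bB by auto
    have EE: "E ?n = {v. \<forall>j\<in>Basis - insert (b ?n) (b ` {..k}). v \<bullet> j = 0}"
      by (simp add: E_def atMost_Suc)
    obtain g G where cont_gG: "continuous_on UNIV g" "continuous_on UNIV G"
      and odd_gG: "\<forall>x. g (- x) = - g x" "\<forall>x. G (- x) = - G x"
      and E_gG: "range g \<subseteq> E ?n" "range G \<subseteq> E ?n"
      and near: "\<forall>x\<in>?SE. norm (F x - g x) < 1"
      and ne: "\<forall>x\<in>?SE. \<forall>t\<in>{0..1}. (1 - t) *\<^sub>R g x + t *\<^sub>R G x \<noteq> 0"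
      and eq: "\<forall>x. x \<bullet> b ?n = 0 \<longrightarrow> G x \<bullet> b ?n = 0"
      using equatorial_perturbation[OF B bn EE contF F_in F_odd] by (elim exE conjE) (rule that)
    note near = bspec[OF near] and ne = bspec[OF bspec[OF ne]]
    have neF: "(1 - t) *\<^sub>R F x + t *\<^sub>R g x \<noteq> 0" if x: "x \<in> ?SE" and t: "t \<in> {0..1}" for x t
    proof
      assume "(1 - t) *\<^sub>R F x + t *\<^sub>R g x = 0"
      then have "F x = t *\<^sub>R (F x - g x)" by (simp add: algebra_simps)
      then have "norm (F x) = t * norm (F x - g x)" using t by (metis abs_of_nonneg atLeastAtMost_iff norm_scaleR)
      also have "\<dots> \<le> norm (F x - g x)" using t by (simp add: mult_left_le_one_le)
      finally show False using near[OF x] F_in x by (auto simp: image_subset_iff)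
    qed
    have F_E: "F ` ?SE \<subseteq> E ?n" using F_in by blast
    have gG_sub: "g ` ?SE \<subseteq> E ?n" "G ` ?SE \<subseteq> E ?n" using E_gG by auto
    have cg: "continuous_on ?SE g" and cG: "continuous_on ?SE G"
      using cont_gG by (auto elim: continuous_on_subset)
    have h1: "homotopic_with (\<lambda>_. True) (nsphere ?n) (nsphere ?n) (nrm F) (nrm g)"
      by (rule homotopic[OF n contF F_E cg gG_sub(1) neF])
    have h2: "homotopic_with (\<lambda>_. True) (nsphere ?n) (nsphere ?n) (nrm g) (nrm G)"
      by (rule homotopic[OF n cg gG_sub(1) cG gG_sub(2) ne])
    have "nrm F x = f x" if "x \<in> ?S ?n" for x
    proof -
      have "F (to x) = to (f x)" using fr_to[OF n that] by (simp add: F_def)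
      moreover have "sgn (to (f x)) = to (f x)"
        using to_in[OF n fS[OF that]] by (simp add: sgn_div_norm)
      ultimately show ?thesis using fr_to[OF n fS[OF that]] by (simp add: nrm_def)
    qed
    then have "Brouwer_degree2 ?n f = Brouwer_degree2 ?n (nrm F)"
      by (intro Brouwer_degree2_eq) auto
    also have "\<dots> = Brouwer_degree2 ?n (nrm G)"
      using Brouwer_degree2_homotopic[OF h1] Brouwer_degree2_homotopic[OF h2] by simp
    finally have deg: "Brouwer_degree2 ?n f = Brouwer_degree2 ?n (nrm G)" .
    have cont: "continuous_map (nsphere ?n) (nsphere ?n) (nrm G)"
      using homotopic_with_imp_continuous_maps[OF h2] by simp
    have odd: "nrm G (\<lambda>i. - x i) = (\<lambda>i. - nrm G x i)" for x
      by (simp add: nrm_def to_neg odd_gG sgn_minus fr_neg)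
    have into: "nrm G x \<in> ?S k" if "x \<in> ?S k" for x
    proof -
      have x: "x \<in> ?S ?n" using topspace_nsphere_mono[of k ?n] that by auto
      have "to x \<bullet> b ?n = 0" using that n by (simp add: to_b topspace_nsphere)
      then have "nrm G x ?n = 0"
        using eq by (simp add: nrm_def fr_def sgn_div_norm)
      moreover have "nrm G x \<in> ?S ?n"
        using continuous_map_image_subset_topspace[OF cont] x by blast
      ultimately show ?thesis
        by (auto simp: topspace_nsphere) (metis Suc_lessI)
    qed
    have "continuous_map (nsphere k) (nsphere k) (nrm G)"
    proof -
      have "continuous_on (?S ?n) (nrm G)" using cont by (simp add: nsphere_top_of_set)
      then have "continuous_on (?S k) (nrm G)"
        by (rule continuous_on_subset) (simp add: topspace_nsphere_mono)
      then show ?thesis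
        unfolding nsphere_top_of_set using into
        by (auto simp: topspace_nsphere image_subset_iff_funcset)
    qed
    from Suc.IH[OF k this odd] have "odd (Brouwer_degree2 k (nrm G))" .
    moreover have "even (Brouwer_degree2 ?n (nrm G) - Brouwer_degree2 (?n - Suc 0) (nrm G))"
      by (rule Borsuk_odd_mapping_degree_step[OF cont]) (use odd into in auto)
    ultimately show ?case using deg by simp
  qed
qed


text \<open>An odd map from \<open>A\<close> to nonzero vectors with \<open>k < m\<close>
  coordinates, composed with \<open>h\<close> and normalized, is an odd self-map of the sphere in
  \<open>m\<close> coordinates. Its degree is odd; but its last coordinate vanishes, so it misses a
  pole and has degree 0.\<close>

theorem Borsuk_Ulam_genus:
  fixes A :: "'b::real_normed_vector set"
  assumes m: "m \<ge> 1" "m \<le> DIM('a::euclidean_space)"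
    and h: "continuous_on (topspace (nsphere (m - 1))) h" "h ` topspace (nsphere (m - 1)) \<subseteq> A"
    and odd: "\<And>x. x \<in> topspace (nsphere (m - 1)) \<Longrightarrow> h (\<lambda>i. - x i) = - h x"
  shows "enat m \<le> genus A"
proof -
  let ?S = "topspace (nsphere (m - 1))"
  have "A \<noteq> {}" using h(2) in_topspace_nsphere by blast
  have "m \<le> k" if k: "k \<ge> 1" "odd_map_exists A k" for k
  proof (rule ccontr)
    assume "\<not> m \<le> k"
    from k(2) obtain g
      where g: "continuous_map (top_of_set A) (subtopology (Euclidean_space k) (- {\<lambda>i. 0})) g"
        and g_odd: "\<And>x. x \<in> A \<Longrightarrow> g (- x) = (\<lambda>i. - g x i)"
      unfolding odd_map_exists_def by blast
    have gk: "g x i = 0" if "x \<in> A" "i \<ge> k" for x i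
      using continuous_map_image_subset_topspace[OF g] that by (auto simp: topspace_Euclidean_space)
    have g0: "g x \<noteq> (\<lambda>i. 0)" if "x \<in> A" for x
      using continuous_map_image_subset_topspace[OF g] imageI[OF that, of g] by auto
    have gc: "continuous_on A g"
      using g by (simp add: continuous_map_in_subtopology Euclidean_space_def euclidean_product_topology)
    define d where "d y = sqrt (\<Sum>j<k. (y j)\<^sup>2)" for y :: "nat \<Rightarrow> real"
    define f where "f x = (\<lambda>i. g (h x) i / d (g (h x)))" for x
    have hA: "h x \<in> A" if "x \<in> ?S" for x using that h(2) by blast
    have d0: "d (g y) > 0" if y: "y \<in> A" for y
    proof -
      obtain i where i: "g y i \<noteq> 0" using g0[OF y] by auto
      then have "i < k" using gk[OF y] not_less by blast
      then have "(\<Sum>j<k. (g y j)\<^sup>2) > 0" using i by (intro sum_pos2[of _ i]) auto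
      then show ?thesis by (simp add: d_def)
    qed
    have fS: "f x \<in> ?S" if x: "x \<in> ?S" for x
    proof -
      have "(\<Sum>i\<le>m - 1. (f x i)\<^sup>2) = (\<Sum>i<k. (f x i)\<^sup>2)"
        using \<open>\<not> m \<le> k\<close> gk[OF hA[OF x]] by (intro sum.mono_neutral_right) (auto simp: f_def)
      also have "\<dots> = (\<Sum>i<k. (g (h x) i)\<^sup>2) / (d (g (h x)))\<^sup>2"
        by (simp add: f_def power_divide sum_divide_distrib)
      also have "\<dots> = 1"
        using d0[OF hA[OF x]] by (simp add: d_def sum_nonneg)
      finally show ?thesis
        using \<open>\<not> m \<le> k\<close> gk[OF hA[OF x]] by (simp add: topspace_nsphere f_def)
    qed
    have cgh: "continuous_on ?S (\<lambda>x. g (h x))"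
      by (rule continuous_on_compose2[OF gc h(1)]) (use hA in auto)
    have cghi: "continuous_on ?S (\<lambda>x. g (h x) i)" for i
      by (rule continuous_on_compose2[OF continuous_on_product_coordinates cgh]) simp
    have "continuous_on ?S f"
    proof (rule continuous_on_coordinatewise_then_product)
      show "continuous_on ?S (\<lambda>x. f x i)" for i
        unfolding f_def d_def using d0[OF hA] by (intro continuous_intros cghi) (force simp: d_def)
    qed
    then have cf: "continuous_map (nsphere (m - 1)) (nsphere (m - 1)) f"
      using fS by (subst (1 2) nsphere_eq_top_of_set_topspace) (auto simp: image_subset_iff_funcset)
    have "f (\<lambda>i. - x i) = (\<lambda>i. - f x i)" if "x \<in> ?S" for x
      using g_odd[OF hA[OF that]] odd[OF that] by (simp add: f_def d_def)
    then have "odd (Brouwer_degree2 (m - 1) f)"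
      using odd_Brouwer_degree2[where 'a = 'a, OF _ cf] m by auto
    moreover have "f ` ?S \<noteq> ?S"
    proof
      assume "f ` ?S = ?S"
      moreover have "(\<lambda>i. if i = m - 1 then 1 else 0) \<in> ?S"
        by (simp add: topspace_nsphere if_distrib[of "\<lambda>t. t\<^sup>2"] cong: if_cong)
      ultimately have "(\<lambda>i. if i = m - 1 then 1 else 0) \<in> f ` ?S" by simp
      then obtain x where x: "(\<lambda>i. if i = m - 1 then 1 else 0) = f x" "x \<in> ?S" by (rule imageE)
      have "f x (m - 1) = 1" using fun_cong[OF x(1), of "m - 1"] by simp
      moreover have "f x (m - 1) = 0"
        using gk[OF hA[OF x(2)], of "m - 1"] \<open>\<not> m \<le> k\<close> by (simp add: f_def)
      ultimately show False by simp
    qed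
    then have "Brouwer_degree2 (m - 1) f = 0"
      by (rule Brouwer_degree2_nonsurjective[OF cf])
    ultimately show False by simp
  qed
  then show ?thesis
    using \<open>A \<noteq> {}\<close> by (auto simp: genus_def intro!: INF_greatest)
qed

section \<open>Maximizers over the base polytope\<close>

text \<open>For each \<open>a\<close> intersect the separating sets over all \<open>b\<close>, then
  take the union over \<open>a\<close>. This turns pairwise separation into simultaneous separation,
  once for the lattice of tight sets and once for the lattice of sets of zero cut.\<close>

lemma lattice_separation:
  fixes P :: "'b::finite set \<Rightarrow> bool"
  assumes P: "P {}" "P UNIV"
    and Un: "\<And>S T. P S \<Longrightarrow> P T \<Longrightarrow> P (S \<union> T)"
    and Int: "\<And>S T. P S \<Longrightarrow> P T \<Longrightarrow> P (S \<inter> T)"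
    and sep: "\<And>a b. a \<in> C \<Longrightarrow> b \<in> D \<Longrightarrow> \<exists>T. P T \<and> a \<in> T \<and> b \<notin> T"
  shows "\<exists>T. P T \<and> C \<subseteq> T \<and> T \<inter> D = {}"
proof -
  from sep obtain T where T: "\<And>a b. a \<in> C \<Longrightarrow> b \<in> D \<Longrightarrow> P (T a b) \<and> a \<in> T a b \<and> b \<notin> T a b"
    by metis
  have "P (\<Inter>b\<in>D. T a b)" if "a \<in> C" for a
  proof -
    have "P (\<Inter>b\<in>X. T a b)" if "X \<subseteq> D" for X
      using finite[of X] that
      by (induction X rule: finite_induct) (use P Int T \<open>a \<in> C\<close> in auto)
    then show ?thesis by blast
  qed
  moreover have "P (\<Union>a\<in>X. \<Inter>b\<in>D. T a b)" if "X \<subseteq> C" "\<And>a. a \<in> C \<Longrightarrow> P (\<Inter>b\<in>D. T a b)" for X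
    using finite[of X] that(1)
    by (induction X rule: finite_induct) (use P Un that(2) in auto)
  ultimately have "P (\<Union>a\<in>C. \<Inter>b\<in>D. T a b)" by blast
  then show ?thesis using T by (intro exI[of _ "\<Union>a\<in>C. \<Inter>b\<in>D. T a b"]) blast
qed

text \<open>Abel summation over the levels of \<open>h\<close>, by merging the two lowest values.\<close>

lemma sum_mult_nonneg_of_superlevels:
  fixes d h :: "'b::finite \<Rightarrow> real"
  assumes "\<And>t. 0 \<le> sum d {v. t < h v}" and "sum d UNIV = 0"
  shows "0 \<le> (\<Sum>v\<in>UNIV. d v * h v)"
  using assms
proof (induction "card (range h)" arbitrary: h rule: less_induct)
  case less
  define m where "m = Min (range h)"
  have m: "m \<le> h v" for v by (simp add: m_def)
  have "m \<in> range h" unfolding m_def by (intro Min_in) auto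
  define T where "T = {v. m < h v}"
  show ?case
  proof (cases "T = {}")
    case True
    then have "\<not> m < h v" for v unfolding T_def by blast
    then have "h v = m" for v using m[of v] by (metis order_le_less)
    then have "(\<Sum>v\<in>UNIV. d v * h v) = sum d UNIV * m" by (simp add: sum_distrib_right)
    then show ?thesis using less.prems by simp
  next
    case False
    define m' where "m' = Min (h ` T)"
    have "m' \<in> h ` T" unfolding m'_def using False by (intro Min_in) auto
    then have mm': "m < m'" and m'r: "m' \<in> range h" by (auto simp: T_def)
    have m': "m' \<le> h v" if "v \<in> T" for v using that by (simp add: m'_def)
    define g where "g v = max (h v) m'" for v
    have g: "g v = h v + (if v \<in> T then 0 else m' - m)" for v
      using m[of v] m'[of v] mm' by (auto simp: g_def T_def max_def)
    have "range g \<subseteq> range h - {m}"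
      using mm' m'r by (auto simp: g_def max_def)
    then have "range g \<subset> range h" using \<open>m \<in> range h\<close> by blast
    then have card: "card (range g) < card (range h)" by (intro psubset_card_mono) auto
    have "0 \<le> sum d {v. t < g v}" for t
    proof (cases "t < m'")
      case True
      then have "{v. t < g v} = UNIV" by (auto simp: g_def)
      then show ?thesis using less.prems by simp
    next
      case False
      then have "{v. t < g v} = {v. t < h v}" by (auto simp: g_def)
      then show ?thesis using less.prems by simp
    qed
    from less.hyps[OF card this less.prems(2)] have "0 \<le> (\<Sum>v\<in>UNIV. d v * g v)" .
    also have "(\<Sum>v\<in>UNIV. d v * g v) = (\<Sum>v\<in>UNIV. d v * h v) + (\<Sum>v\<in>UNIV. if v \<in> - T then d v * (m' - m) else 0)"
      unfolding g by (subst sum.distrib[symmetric], intro sum.cong) (auto simp: algebra_simps)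
    also have "(\<Sum>v\<in>UNIV. if v \<in> - T then d v * (m' - m) else 0) = sum d (- T) * (m' - m)"
      by (simp add: sum.If_cases sum_distrib_right Compl_eq)
    also have "sum d (- T) = - sum d T"
      using less.prems(2) sum.union_disjoint[of T "- T" d] by (simp add: Compl_partition)
    finally have "sum d T * (m' - m) \<le> (\<Sum>v\<in>UNIV. d v * h v)" by simp
    moreover have "0 \<le> sum d T * (m' - m)"
      using less.prems(1)[of m] mm' by (simp add: T_def)
    ultimately show ?thesis by linarith
  qed
qed

definition restr :: "real ^ 'n \<Rightarrow> 'n set \<Rightarrow> real ^ 'n" where
  "restr x C = (\<chi> v. if v \<in> C then x $ v else 0)"

lemma restr_nth [simp]: "restr x C $ v = (if v \<in> C then x $ v else 0)"
  by (simp add: restr_def)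

lemma restr_uminus: "restr (- x) C = - restr x C"
  by (simp add: vec_eq_iff)

lemma sum_vec_eq_inner: "(\<Sum>v\<in>S. y $ v) = y \<bullet> restr 1 S"
  by (simp add: inner_vec_def if_distrib sum.If_cases cong: if_cong)

context submodular_hypergraph
begin

abbreviation cut :: "'n set \<Rightarrow> 'n set \<Rightarrow> real" where
  "cut e S \<equiv> w e (S \<inter> e)"

abbreviation tight :: "'n set \<Rightarrow> real ^ 'n \<Rightarrow> 'n set \<Rightarrow> bool" where
  "tight e u S \<equiv> (\<Sum>v\<in>S. u $ v) = cut e S"

lemma cut_nonneg: "e \<in> E \<Longrightarrow> 0 \<le> cut e S"
  and cut_le_1: "e \<in> E \<Longrightarrow> cut e S \<le> 1"
  using w_range[of e "S \<inter> e"] by auto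

lemma cut_submodular:
  assumes "e \<in> E"
  shows "cut e (S \<union> T) + cut e (S \<inter> T) \<le> cut e S + cut e T"
proof -
  have "(S \<union> T) \<inter> e = (S \<inter> e) \<union> (T \<inter> e)" "(S \<inter> T) \<inter> e = (S \<inter> e) \<inter> (T \<inter> e)" by auto
  then show ?thesis using w_submodular[OF assms, of "S \<inter> e" "T \<inter> e"] by simp
qed

lemma cut_Compl:
  assumes "e \<in> E"
  shows "cut e (- S) = cut e S"
proof -
  have "- S \<inter> e = e - S \<inter> e" by auto
  then show ?thesis using w_symmetric[OF assms, of "S \<inter> e"] by simp
qed

lemma cut_empty: "e \<in> E \<Longrightarrow> cut e {} = 0"
  by (simp add: w_empty)

lemma cut_UNIV: "e \<in> E \<Longrightarrow> cut e UNIV = 0"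
  using cut_Compl[of e "{}"] cut_empty[of e] by simp

lemma base_sum_le: "y \<in> base_polytope w e \<Longrightarrow> (\<Sum>v\<in>S. y $ v) \<le> cut e S"
  and base_sum_UNIV: "y \<in> base_polytope w e \<Longrightarrow> (\<Sum>v\<in>UNIV. y $ v) = 0"
  by (auto simp: base_polytope_def)

lemma base_sum_Compl:
  assumes "y \<in> base_polytope w e"
  shows "(\<Sum>v\<in>- S. y $ v) = - (\<Sum>v\<in>S. y $ v)"
proof -
  have "(\<Sum>v\<in>S \<union> - S. y $ v) = (\<Sum>v\<in>S. y $ v) + (\<Sum>v\<in>- S. y $ v)"
    by (rule sum.union_disjoint) auto
  then show ?thesis using base_sum_UNIV[OF assms] by (simp add: Compl_partition)
qed

lemma base_uminus:
  assumes "e \<in> E" "y \<in> base_polytope w e"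
  shows "- y \<in> base_polytope w e"
proof -
  have "- (\<Sum>v\<in>S. y $ v) \<le> cut e S" for S
    using base_sum_le[OF assms(2), of "- S"] base_sum_Compl[OF assms(2), of S] cut_Compl[OF assms(1), of S]
    by simp
  then show ?thesis
    using base_sum_UNIV[OF assms(2)] by (simp add: base_polytope_def sum_negf)
qed

lemma zero_base: "e \<in> E \<Longrightarrow> 0 \<in> base_polytope w e"
  using cut_nonneg by (auto simp: base_polytope_def)

lemma base_zero_outside:
  assumes "e \<in> E" "y \<in> base_polytope w e" "v \<notin> e"
  shows "y $ v = 0"
  using base_sum_le[OF assms(2), of "{v}"] base_sum_le[OF base_uminus[OF assms(1,2)], of "{v}"]
    assms w_empty by simp

lemma base_abs_le:
  assumes "e \<in> E" "y \<in> base_polytope w e"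
  shows "\<bar>y $ v\<bar> \<le> 1"
  using base_sum_le[OF assms(2), of "{v}"] base_sum_le[OF base_uminus[OF assms], of "{v}"]
    cut_le_1[OF assms(1), of "{v}"] by simp

lemma base_sum_cong:
  assumes "e \<in> E" "y \<in> base_polytope w e" "S \<inter> e = T \<inter> e"
  shows "(\<Sum>v\<in>S. y $ v) = (\<Sum>v\<in>T. y $ v)"
proof -
  have "(\<Sum>v\<in>S \<inter> e. y $ v) = (\<Sum>v\<in>S. y $ v)" for S
    using base_zero_outside[OF assms(1,2)] by (intro sum.mono_neutral_left) auto
  then show ?thesis using assms(3) by metis
qed

lemma compact_base: "e \<in> E \<Longrightarrow> compact (base_polytope w e)"
proof -
  assume e: "e \<in> E"
  have "closed (base_polytope w e)"
    unfolding base_polytope_def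
    by (intro closed_Collect_conj closed_Collect_all closed_Collect_le closed_Collect_eq continuous_intros)
  moreover have "bounded (base_polytope w e)"
  proof -
    have "norm y \<le> real CARD('n)" if "y \<in> base_polytope w e" for y
      using norm_le_l1_cart[of y] sum_mono[of UNIV "\<lambda>v. \<bar>y $ v\<bar>" "\<lambda>_. 1"] base_abs_le[OF e that] by simp
    then show ?thesis by (rule boundedI)
  qed
  ultimately show ?thesis by (simp add: compact_eq_bounded_closed)
qed

lemma lovasz_attained:
  assumes "e \<in> E"
  obtains u where "u \<in> base_polytope w e" "u \<bullet> x = lovasz_ext w e x"
    "\<And>y. y \<in> base_polytope w e \<Longrightarrow> y \<bullet> x \<le> lovasz_ext w e x"
proof -
  have "continuous_on (base_polytope w e) (\<lambda>y. y \<bullet> x)" by (intro continuous_intros)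
  from continuous_attains_sup[OF compact_base[OF assms] _ this] zero_base[OF assms]
  obtain u where u: "u \<in> base_polytope w e" "\<And>y. y \<in> base_polytope w e \<Longrightarrow> y \<bullet> x \<le> u \<bullet> x" by blast
  then have "lovasz_ext w e x = u \<bullet> x"
    unfolding lovasz_ext_def by (intro cSup_eq_maximum) auto
  then show thesis using that u by simp
qed

lemma lovasz_ge:
  assumes "e \<in> E" "y \<in> base_polytope w e"
  shows "y \<bullet> x \<le> lovasz_ext w e x"
  by (rule lovasz_attained[OF assms(1), of x]) (use assms(2) in blast)

lemma lovasz_subdiff_iff:
  assumes "e \<in> E"
  shows "u \<in> lovasz_subdiff w e x \<longleftrightarrow> u \<in> base_polytope w e \<and> u \<bullet> x = lovasz_ext w e x"
proof -
  obtain u0 where u0: "u0 \<in> base_polytope w e" "u0 \<bullet> x = lovasz_ext w e x"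
    using lovasz_attained[OF assms, of x] by blast
  show ?thesis
  proof
    assume "u \<in> lovasz_subdiff w e x"
    then have u: "u \<in> base_polytope w e" "\<not> u \<bullet> x < u0 \<bullet> x"
      using u0(1) by (auto simp: lovasz_subdiff_def is_arg_max_def)
    then show "u \<in> base_polytope w e \<and> u \<bullet> x = lovasz_ext w e x"
      using u0(2) lovasz_ge[OF assms u(1), of x] by simp
  next
    assume "u \<in> base_polytope w e \<and> u \<bullet> x = lovasz_ext w e x"
    then show "u \<in> lovasz_subdiff w e x"
      using lovasz_ge[OF assms, of _ x] by (auto simp: lovasz_subdiff_def is_arg_max_def not_less)
  qed
qed

lemma lovasz_subdiffE:
  assumes "e \<in> E"
  obtains u where "u \<in> lovasz_subdiff w e x"
proof -
  obtain u where "u \<in> base_polytope w e" "u \<bullet> x = lovasz_ext w e x"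
    using lovasz_attained[OF assms, of x] by blast
  then show thesis using that lovasz_subdiff_iff[OF assms] by blast
qed

lemma lovasz_nonneg: "e \<in> E \<Longrightarrow> 0 \<le> lovasz_ext w e x"
  using lovasz_ge[OF _ zero_base, of e x] by simp

lemma lovasz_zero:
  assumes "e \<in> E"
  shows "lovasz_ext w e 0 = 0"
proof -
  obtain u where "u \<in> base_polytope w e" "u \<bullet> 0 = lovasz_ext w e 0"
    using lovasz_attained[OF assms, of 0] by blast
  then show ?thesis by simp
qed

lemma lovasz_uminus_le:
  assumes "e \<in> E"
  shows "lovasz_ext w e (- x) \<le> lovasz_ext w e x"
proof -
  obtain u where u: "u \<in> base_polytope w e" "u \<bullet> (- x) = lovasz_ext w e (- x)"
    using lovasz_attained[OF assms, of "- x"] by blast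
  then show ?thesis using lovasz_ge[OF assms base_uminus[OF assms u(1)], of x] by simp
qed

lemma lovasz_uminus: "e \<in> E \<Longrightarrow> lovasz_ext w e (- x) = lovasz_ext w e x"
  by (metis add.inverse_inverse lovasz_uminus_le order_antisym)

lemma lovasz_add_le:
  assumes "e \<in> E"
  shows "lovasz_ext w e (x + y) \<le> lovasz_ext w e x + lovasz_ext w e y"
proof -
  obtain u where u: "u \<in> base_polytope w e" "u \<bullet> (x + y) = lovasz_ext w e (x + y)"
    using lovasz_attained[OF assms, of "x + y"] by blast
  then show ?thesis
    using lovasz_ge[OF assms u(1), of x] lovasz_ge[OF assms u(1), of y] by (simp add: inner_add_right)
qed

lemma lovasz_scaleR_le:
  assumes "e \<in> E" "0 \<le> c"
  shows "lovasz_ext w e (c *\<^sub>R x) \<le> c * lovasz_ext w e x"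
proof -
  obtain u where u: "u \<in> base_polytope w e" "u \<bullet> (c *\<^sub>R x) = lovasz_ext w e (c *\<^sub>R x)"
    using lovasz_attained[OF assms(1), of "c *\<^sub>R x"] by blast
  then show ?thesis
    using mult_left_mono[OF lovasz_ge[OF assms(1) u(1), of x] assms(2)] by simp
qed

lemma lovasz_scaleR_nonneg:
  assumes "e \<in> E" "0 \<le> c"
  shows "lovasz_ext w e (c *\<^sub>R x) = c * lovasz_ext w e x"
proof (cases "c = 0")
  case True
  then show ?thesis using lovasz_zero assms by simp
next
  case False
  then have "lovasz_ext w e x \<le> (1 / c) * lovasz_ext w e (c *\<^sub>R x)"
    using lovasz_scaleR_le[OF assms(1), of "1 / c" "c *\<^sub>R x"] assms by simp
  then show ?thesis
    using lovasz_scaleR_le[OF assms, of x] assms False by (simp add: field_simps)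
qed

lemma lovasz_scaleR:
  assumes "e \<in> E"
  shows "lovasz_ext w e (c *\<^sub>R x) = \<bar>c\<bar> * lovasz_ext w e x"
proof (cases "0 \<le> c")
  case True
  then show ?thesis using lovasz_scaleR_nonneg assms by simp
next
  case False
  then have "lovasz_ext w e (- (c *\<^sub>R x)) = - c * lovasz_ext w e x"
    using lovasz_scaleR_nonneg[OF assms, of "- c" x] by simp
  then show ?thesis using False lovasz_uminus[OF assms, of "c *\<^sub>R x"] by simp
qed

lemma lovasz_sum_le:
  assumes "e \<in> E" "finite I"
  shows "lovasz_ext w e (\<Sum>i\<in>I. z i) \<le> (\<Sum>i\<in>I. lovasz_ext w e (z i))"
  using assms(2)
proof (induction I rule: finite_induct)
  case empty
  then show ?case using lovasz_zero assms by simp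
next
  case (insert i I)
  then show ?case using lovasz_add_le[OF assms(1), of "z i" "sum z I"] by simp
qed

lemma convex_on_lovasz: "e \<in> E \<Longrightarrow> convex_on UNIV (lovasz_ext w e)"
proof (intro convex_onI)
  fix t :: real and x y :: "real ^ 'n"
  assume e: "e \<in> E" and "0 < t" "t < 1"
  then show "lovasz_ext w e ((1 - t) *\<^sub>R x + t *\<^sub>R y) \<le> (1 - t) * lovasz_ext w e x + t * lovasz_ext w e y"
    using lovasz_add_le[OF e, of "(1 - t) *\<^sub>R x" "t *\<^sub>R y"] by (simp add: lovasz_scaleR[OF e])
qed simp

lemma continuous_on_lovasz: "e \<in> E \<Longrightarrow> continuous_on S (lovasz_ext w e)"
  using convex_on_continuous[OF open_UNIV convex_on_lovasz] continuous_on_subset by blast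

lemma subdiff_base: "e \<in> E \<Longrightarrow> u \<in> lovasz_subdiff w e x \<Longrightarrow> u \<in> base_polytope w e"
  by (simp add: lovasz_subdiff_iff)

lemma subdiff_uminus: "e \<in> E \<Longrightarrow> u \<in> lovasz_subdiff w e x \<Longrightarrow> - u \<in> lovasz_subdiff w e (- x)"
  by (simp add: lovasz_subdiff_iff base_uminus lovasz_uminus)

lemma zero_subdiff: "e \<in> E \<Longrightarrow> lovasz_ext w e x = 0 \<Longrightarrow> 0 \<in> lovasz_subdiff w e x"
  by (simp add: lovasz_subdiff_iff zero_base)

lemma tight_UNIV: "e \<in> E \<Longrightarrow> u \<in> base_polytope w e \<Longrightarrow> tight e u UNIV"
  using base_sum_UNIV cut_UNIV by simp

lemma tight_Un_Int:
  assumes e: "e \<in> E" and u: "u \<in> base_polytope w e" and "tight e u S" "tight e u T"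
  shows "tight e u (S \<union> T)" and "tight e u (S \<inter> T)"
proof -
  have "(\<Sum>v\<in>S \<union> T. u $ v) + (\<Sum>v\<in>S \<inter> T. u $ v) = (\<Sum>v\<in>S. u $ v) + (\<Sum>v\<in>T. u $ v)"
    by (rule sum.union_inter) auto
  then show "tight e u (S \<union> T)" "tight e u (S \<inter> T)"
    using cut_submodular[OF e, of S T] base_sum_le[OF u, of "S \<union> T"] base_sum_le[OF u, of "S \<inter> T"] assms(3,4)
    by linarith+
qed

text \<open>
  If no tight set contained \<open>a\<close> but not \<open>b\<close> while \<open>x $ b < x $ a\<close>, moving a little mass of the
  maximizer from \<open>b\<close> to \<open>a\<close> would increase the pairing with \<open>x\<close>.
\<close>

lemma tight_upper_set:
  assumes e: "e \<in> E" and u: "u \<in> lovasz_subdiff w e x"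
    and C: "\<And>a b. a \<in> C \<Longrightarrow> b \<notin> C \<Longrightarrow> x $ b < x $ a"
  shows "tight e u C"
proof -
  note ub = subdiff_base[OF e u]
  have "\<exists>T. tight e u T \<and> C \<subseteq> T \<and> T \<inter> (- C) = {}"
  proof (rule lattice_separation)
    show "tight e u {}" using cut_empty[OF e] by simp
    show "tight e u UNIV" by (rule tight_UNIV[OF e ub])
    show "\<exists>T. tight e u T \<and> a \<in> T \<and> b \<notin> T" if "a \<in> C" "b \<in> - C" for a b
    proof (rule ccontr)
      assume none: "\<not> ?thesis"
      have ab: "x $ b < x $ a" using C that by blast
      define \<T> where "\<T> = {T. a \<in> T \<and> b \<notin> T}"
      \<comment> \<open>The least slack among the constraints that the move from \<open>b\<close> to
        \<open>a\<close> tightens, namely those of sets containing \<open>a\<close> but not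
        \<open>b\<close>. It is positive because none of these sets is tight.\<close>
      define \<epsilon> where "\<epsilon> = Min ((\<lambda>T. cut e T - (\<Sum>v\<in>T. u $ v)) ` \<T>)"
      have "{a} \<in> \<T>" using ab by (auto simp: \<T>_def)
      then have "\<epsilon> \<in> (\<lambda>T. cut e T - (\<Sum>v\<in>T. u $ v)) ` \<T>"
        unfolding \<epsilon>_def by (intro Min_in) auto
      then obtain T where T: "T \<in> \<T>" "\<epsilon> = cut e T - (\<Sum>v\<in>T. u $ v)" by blast
      then have pos: "\<epsilon> > 0"
        using none base_sum_le[OF ub, of T] by (force simp: \<T>_def)
      have slack: "\<epsilon> \<le> cut e T - (\<Sum>v\<in>T. u $ v)" if "T \<in> \<T>" for T
        unfolding \<epsilon>_def using that by (intro Min_le) auto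
      define y where "y = u + \<epsilon> *\<^sub>R (axis a 1 - axis b 1)"
      have sum_y: "(\<Sum>v\<in>S. y $ v) = (\<Sum>v\<in>S. u $ v) + \<epsilon> * ((if a \<in> S then 1 else 0) - (if b \<in> S then 1 else 0))" for S
        by (simp add: y_def axis_def sum.distrib sum_subtractf algebra_simps flip: sum_distrib_left)
      have "(\<Sum>v\<in>S. y $ v) \<le> cut e S" for S
        using slack[of S] base_sum_le[OF ub, of S] pos by (auto simp: sum_y \<T>_def)
      then have "y \<in> base_polytope w e"
        using base_sum_UNIV[OF ub] by (simp add: base_polytope_def sum_y)
      then have "y \<bullet> x \<le> u \<bullet> x"
        using lovasz_ge[OF e] u by (simp add: lovasz_subdiff_iff[OF e])
      moreover have "y \<bullet> x = u \<bullet> x + \<epsilon> * (x $ a - x $ b)"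
        by (simp add: y_def inner_add_left inner_diff_left inner_axis')
      ultimately show False using pos ab by (simp add: mult_le_0_iff)
    qed
  qed (use tight_Un_Int[OF e ub] in blast)+
  then obtain T where "tight e u T" "C \<subseteq> T" "T \<inter> (- C) = {}" by blast
  then show ?thesis by (metis Compl_disjoint2 disjoint_eq_subset_Compl double_compl subset_antisym)
qed

text \<open>The optimality criterion of the greedy algorithm: against any competitor
  \<open>y\<close>, the difference \<open>u - y\<close> has nonnegative sums over the superlevel
  sets of \<open>h\<close> and total sum 0, so Abel summation compares the pairings.\<close>

lemma inner_eq_lovasz_of_tight:
  assumes e: "e \<in> E" and u: "u \<in> base_polytope w e" and t: "\<And>t. tight e u {v. t < h $ v}"
  shows "u \<bullet> h = lovasz_ext w e h"
proof -
  obtain y where y: "y \<in> base_polytope w e" "y \<bullet> h = lovasz_ext w e h"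
    using lovasz_attained[OF e] by metis
  have "0 \<le> (\<Sum>v\<in>UNIV. (u $ v - y $ v) * h $ v)"
    by (rule sum_mult_nonneg_of_superlevels)
      (use t base_sum_le[OF y(1)] base_sum_UNIV[OF u] base_sum_UNIV[OF y(1)] in \<open>simp_all add: sum_subtractf\<close>)
  then have "y \<bullet> h \<le> u \<bullet> h"
    by (simp add: inner_vec_def left_diff_distrib sum_subtractf)
  then show ?thesis using lovasz_ge[OF e u, of h] y by simp
qed

text \<open>By symmetry the complement of \<open>Z\<close> also has cut 0. Since \<open>u\<close>
  has total sum 0, its sum over \<open>Z\<close> is at most 0 and at least 0.\<close>

lemma tight_zero_set:
  assumes e: "e \<in> E" and u: "u \<in> base_polytope w e" and "cut e Z = 0"
  shows "tight e u Z"
  using base_sum_le[OF u, of Z] base_sum_le[OF u, of "- Z"] base_sum_Compl[OF u, of Z] cut_Compl[OF e, of Z] assms(3)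
  by simp

section \<open>Adjacency, sets of zero cut and components\<close>

lemma nonadjacent_zero_set:
  assumes "e \<in> E" "a \<in> e" "b \<in> e" "(a, b) \<notin> adjacency E w"
  shows "\<exists>Z. cut e Z = 0 \<and> a \<in> Z \<and> b \<notin> Z"
proof -
  obtain Z where Z: "Z \<subseteq> e" "a \<in> Z" "b \<notin> Z" "\<not> w e Z > 0"
    using assms by (auto simp: adjacency_def)
  then have "cut e Z = 0" using cut_nonneg[OF assms(1), of Z] by (simp add: Int_absorb2)
  then show ?thesis using Z by blast
qed

text \<open>Sets of zero cut are closed under union and intersection because the cut function is
  submodular and nonnegative. Everything is intersected with \<open>e\<close>, since nonadjacency
  yields a zero set only for pairs of vertices of \<open>e\<close>.\<close>

lemma zero_set_separation:
  assumes e: "e \<in> E"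
    and "\<And>a b. a \<in> C \<inter> e \<Longrightarrow> b \<in> D \<inter> e \<Longrightarrow> \<exists>Z. cut e Z = 0 \<and> a \<in> Z \<and> b \<notin> Z"
  shows "\<exists>Z. cut e Z = 0 \<and> C \<inter> e \<subseteq> Z \<and> Z \<inter> (D \<inter> e) = {}"
proof (rule lattice_separation)
  fix S T assume "cut e S = 0" "cut e T = 0"
  then show "cut e (S \<union> T) = 0" "cut e (S \<inter> T) = 0"
    using cut_submodular[OF e, of S T] cut_nonneg[OF e, of "S \<union> T"] cut_nonneg[OF e, of "S \<inter> T"] by auto
qed (use assms cut_empty cut_UNIV in auto)

lemma adjacency_sym: "sym (adjacency E w)"
proof (rule symI)
  fix a b assume "(a, b) \<in> adjacency E w"
  then obtain e where e: "e \<in> E" "a \<in> e" "b \<in> e" "\<And>S. S \<subseteq> e \<Longrightarrow> a \<in> S \<Longrightarrow> b \<notin> S \<Longrightarrow> w e S > 0"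
    by (auto simp: adjacency_def)
  have "w e S > 0" if "S \<subseteq> e" "b \<in> S" "a \<notin> S" for S
    using e(4)[of "e - S"] e(2,3) that w_symmetric[OF e(1) that(1)] by auto
  then show "(b, a) \<in> adjacency E w" using e by (auto simp: adjacency_def)
qed

lemma adjacency_cut_pos:
  assumes "(a, b) \<in> adjacency E w"
  obtains e where "e \<in> E" "\<And>S. a \<in> S \<Longrightarrow> b \<notin> S \<Longrightarrow> cut e S > 0" "\<And>S. b \<in> S \<Longrightarrow> a \<notin> S \<Longrightarrow> cut e S > 0"
proof -
  obtain e where e: "e \<in> E" "a \<in> e" "b \<in> e" "\<And>S. S \<subseteq> e \<Longrightarrow> a \<in> S \<Longrightarrow> b \<notin> S \<Longrightarrow> w e S > 0"
    using assms by (auto simp: adjacency_def)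
  have 1: "cut e S > 0" if "a \<in> S" "b \<notin> S" for S using e that by simp
  have "cut e S > 0" if "b \<in> S" "a \<notin> S" for S
    using 1[of "- S"] that cut_Compl[OF e(1), of S] by simp
  then show thesis using that e 1 by blast
qed

lemma rtrancl_Restr_in:
  assumes "(a, b) \<in> (Restr (adjacency E w) A)\<^sup>*" "a \<in> A"
  shows "b \<in> A"
  using assms by (induction rule: rtrancl_induct) auto

lemma component_subset: "C \<in> conn_components E w A \<Longrightarrow> C \<subseteq> A"
  and component_nonempty: "C \<in> conn_components E w A \<Longrightarrow> C \<noteq> {}"
  using rtrancl_Restr_in by (auto simp: conn_components_def quotient_def)

lemma component_closed:
  assumes "C \<in> conn_components E w A" "a \<in> C" "b \<in> A" "(a, b) \<in> adjacency E w"
  shows "b \<in> C"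
proof -
  obtain c where c: "c \<in> A" "C = (Restr (adjacency E w) A)\<^sup>* `` {c}"
    using assms(1) by (auto simp: conn_components_def quotient_def)
  moreover have "a \<in> A" using component_subset assms(1,2) by blast
  ultimately show ?thesis
    using assms by (auto intro: rtrancl_into_rtrancl)
qed

lemma component_closed':
  "C \<in> conn_components E w A \<Longrightarrow> a \<in> C \<Longrightarrow> b \<in> A \<Longrightarrow> (b, a) \<in> adjacency E w \<Longrightarrow> b \<in> C"
  using component_closed adjacency_sym by (meson symD)

lemma components_disjoint:
  assumes "C \<in> conn_components E w A" "D \<in> conn_components E w A" "v \<in> C" "v \<in> D"
  shows "C = D"
proof -
  let ?R = "(Restr (adjacency E w) A)\<^sup>*"
  have "sym ?R"
    using adjacency_sym by (intro sym_rtrancl) (auto simp: sym_def)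
  obtain c d where C: "C = ?R `` {c}" and D: "D = ?R `` {d}"
    using assms(1,2) by (auto simp: conn_components_def quotient_def)
  have cv: "(c, v) \<in> ?R" and dv: "(d, v) \<in> ?R" using assms(3,4) by (auto simp: C D)
  have "(c, z) \<in> ?R \<longleftrightarrow> (d, z) \<in> ?R" for z
    using cv dv \<open>sym ?R\<close> by (meson rtrancl_trans symD)
  then show ?thesis by (auto simp: C D)
qed

lemma component_cover:
  assumes "v \<in> A"
  obtains C where "C \<in> conn_components E w A" "v \<in> C"
  using assms that[of "(Restr (adjacency E w) A)\<^sup>* `` {v}"] by (auto simp: conn_components_def quotient_def)

text \<open>No vertex of \<open>C\<close> is adjacent to one of \<open>A - C\<close>, so the two can
  be separated inside \<open>e\<close>. Among subsets of \<open>A\<close>, intersecting with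
  \<open>C\<close> thus amounts to intersecting with a zero set, and a zero set is tight for every
  point of the base polytope.\<close>

lemma component_zero_set:
  assumes e: "e \<in> E" and C: "C \<in> conn_components E w A"
  shows "\<exists>Z. cut e Z = 0 \<and> Z \<inter> A \<inter> e = C \<inter> e"
proof -
  have "\<exists>Z. cut e Z = 0 \<and> C \<inter> e \<subseteq> Z \<and> Z \<inter> ((A - C) \<inter> e) = {}"
    using component_closed[OF C] by (intro zero_set_separation[OF e] nonadjacent_zero_set[OF e]) auto
  then show ?thesis using component_subset[OF C] by blast
qed

lemma tight_component:
  assumes e: "e \<in> E" and u: "u \<in> base_polytope w e" and C: "C \<in> conn_components E w A"
    and T: "T \<subseteq> A" "tight e u T"
  shows "tight e u (T \<inter> C)"
proof -
  obtain Z where Z: "cut e Z = 0" "Z \<inter> A \<inter> e = C \<inter> e" using component_zero_set[OF e C] by blast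
  have "tight e u (T \<inter> Z)"
    by (rule tight_Un_Int(2)[OF e u T(2) tight_zero_set[OF e u Z(1)]])
  moreover have eq: "T \<inter> Z \<inter> e = T \<inter> C \<inter> e" using Z(2) T(1) by blast
  ultimately show ?thesis using base_sum_cong[OF e u eq] by simp
qed

text \<open>The hypotheses on \<open>A\<close> fit both the positive and the nonnegative vertices of
  \<open>x\<close>. The superlevel sets of the restriction are everything for negative
  \<open>t\<close>, and otherwise the part in \<open>C\<close> of an upper set of \<open>x\<close>
  inside \<open>A\<close>, so each of them is tight.\<close>

lemma inner_restr_component:
  assumes e: "e \<in> E" and u: "u \<in> lovasz_subdiff w e x" and C: "C \<in> conn_components E w A"
    and A: "\<And>v. v \<in> A \<Longrightarrow> 0 \<le> x $ v" "\<And>a b. a \<in> A \<Longrightarrow> b \<notin> A \<Longrightarrow> x $ b < x $ a"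
  shows "u \<bullet> restr x C = lovasz_ext w e (restr x C)"
proof (rule inner_eq_lovasz_of_tight[OF e subdiff_base[OF e u]])
  note ub = subdiff_base[OF e u]
  fix t
  show "tight e u {v. t < restr x C $ v}"
  proof (cases "0 \<le> t")
    case True
    have "tight e u ({v. t < x $ v} \<inter> A)"
      by (rule tight_upper_set[OF e u]) (use A(2) in force)
    then have "tight e u ({v. t < x $ v} \<inter> A \<inter> C)"
      by (intro tight_component[OF e ub C]) auto
    moreover have "{v. t < restr x C $ v} = {v. t < x $ v} \<inter> A \<inter> C"
      using True component_subset[OF C] by auto
    ultimately show ?thesis by simp
  next
    case False
    have "t < restr x C $ v" for v using False A(1)[of v] component_subset[OF C] by auto
    then have "{v. t < restr x C $ v} = UNIV" by auto
    then show ?thesis using tight_UNIV[OF e ub] by simp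
  qed
qed

text \<open>When the extension vanishes at \<open>h\<close>, the point 0 is itself a maximizer, and
  tightness of 0 on a superlevel set says that its cut is 0.\<close>

lemma lovasz_zero_cut:
  assumes "e \<in> E" "lovasz_ext w e h = 0"
  shows "cut e {v. t < h $ v} = 0"
  using tight_upper_set[OF assms(1) zero_subdiff[OF assms], of "{v. t < h $ v}"] by auto

end

section \<open>The energy of combinations of nodal domains\<close>

lemma powr_above_tangent:
  fixes a s p :: real
  assumes p: "p > 1" and a: "0 \<le> a" and s: "0 \<le> s"
  shows "a powr p + p * a powr (p - 1) * (s - a) \<le> s powr p"
    and "s \<noteq> a \<Longrightarrow> a powr p + p * a powr (p - 1) * (s - a) < s powr p"
proof -
  have strict: "a powr p + p * a powr (p - 1) * (s - a) < s powr p" if ne: "s \<noteq> a"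
  proof (cases "a = 0")
    case True
    then show ?thesis using ne s p by simp
  next
    case False
    then have a0: "a > 0" using a by simp
    \<comment> \<open>The endpoint \<open>s = 0\<close> is computed directly, because the mean value
      theorem is applied with \<open>der\<close>, which covers positive arguments only.\<close>
    show ?thesis
    proof (cases "s = 0")
      case True
      have "a powr p = a powr (p - 1) * a" using a0 by (simp add: powr_mult_base mult.commute)
      then have "a powr p + p * a powr (p - 1) * (s - a) = (1 - p) * a powr p"
        using True by (simp add: algebra_simps)
      also have "\<dots> < 0" using p a0 by (simp add: mult_neg_pos)
      finally show ?thesis using True by simp
    next
      case False
      then have s0: "s > 0" using s by simp
      have der: "((\<lambda>x. x powr p) has_real_derivative p * x powr (p - 1)) (at x)" if "x > 0" for x
        using that by (auto intro!: derivative_eq_intros)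
      show ?thesis
      proof (cases "a < s")
        case True
        obtain z where z: "a < z" "z < s" "s powr p - a powr p = (s - a) * (p * z powr (p - 1))"
          using MVT2[OF True, of "\<lambda>x. x powr p" "\<lambda>x. p * x powr (p - 1)"] der a0 by auto
        have "(s - a) * (p * a powr (p - 1)) < (s - a) * (p * z powr (p - 1))"
          using True p a0 z by (intro mult_strict_left_mono powr_less_mono2) auto
        then show ?thesis using z(3) by (simp add: algebra_simps)
      next
        case False
        then have sa: "s < a" using ne by simp
        obtain z where z: "s < z" "z < a" "a powr p - s powr p = (a - s) * (p * z powr (p - 1))"
          using MVT2[OF sa, of "\<lambda>x. x powr p" "\<lambda>x. p * x powr (p - 1)"] der s0 by auto
        have "(a - s) * (p * z powr (p - 1)) < (a - s) * (p * a powr (p - 1))"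
          using sa p s0 z by (intro mult_strict_left_mono powr_less_mono2) auto
        then show ?thesis using z(3) by (simp add: algebra_simps)
      qed
    qed
  qed
  then show "a powr p + p * a powr (p - 1) * (s - a) \<le> s powr p"
    by (cases "s = a") auto
  show "s \<noteq> a \<Longrightarrow> a powr p + p * a powr (p - 1) * (s - a) < s powr p"
    by (rule strict)
qed

text \<open>Jensen's inequality for the power \<open>p\<close>, in a homogeneous form: the weights
  need not add up to 1. In \<open>energy_comb\<close> they are the Lovasz extensions of the
  restrictions, whose total is that of \<open>x\<close>.\<close>

lemma weighted_power_mean:
  fixes c a :: "'b \<Rightarrow> real" and p :: real
  assumes p: "p > 1" and I: "finite I"
    and c: "\<And>i. i \<in> I \<Longrightarrow> 0 \<le> c i" and a: "\<And>i. i \<in> I \<Longrightarrow> 0 \<le> a i"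
  shows "(\<Sum>i\<in>I. a i * c i) powr p \<le> (\<Sum>i\<in>I. c i) powr (p - 1) * (\<Sum>i\<in>I. a i powr p * c i)"
    and "\<lbrakk>(\<Sum>i\<in>I. a i * c i) powr p = (\<Sum>i\<in>I. c i) powr (p - 1) * (\<Sum>i\<in>I. a i powr p * c i);
      i \<in> I; j \<in> I; 0 < c i; 0 < c j\<rbrakk> \<Longrightarrow> a i = a j"
proof -
  define F where "F = (\<Sum>i\<in>I. c i)"
  define m where "m = (\<Sum>i\<in>I. a i * c i) / F"
  \<comment> \<open>The weighted gap between the power function and its tangent at the mean
    \<open>m\<close>. The linear terms cancel in the sum, so the total gap is, up to a factor, the
    difference of the two sides; strictness of the tangent inequality then settles the equality
    case.\<close>
  define r where "r i = c i * (a i powr p - (m powr p + p * m powr (p - 1) * (a i - m)))" for i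
  have F0: "0 \<le> F" unfolding F_def using c by (rule sum_nonneg)
  have m0: "0 \<le> m" unfolding m_def using F0 c a by (intro divide_nonneg_nonneg sum_nonneg) auto
  have r0: "0 \<le> r i" if "i \<in> I" for i
    unfolding r_def using c[OF that] powr_above_tangent(1)[OF p m0 a[OF that]] by simp
  have main: "(\<Sum>i\<in>I. c i) powr (p - 1) * (\<Sum>i\<in>I. a i powr p * c i)
      = (\<Sum>i\<in>I. a i * c i) powr p + F powr (p - 1) * (\<Sum>i\<in>I. r i)" if "F > 0"
  proof -
    have Fm: "(\<Sum>i\<in>I. a i * c i) = F * m" using that by (simp add: m_def)
    have "(\<Sum>i\<in>I. r i) = (\<Sum>i\<in>I. a i powr p * c i - m powr p * c i
        - p * m powr (p - 1) * (a i * c i) + p * m powr (p - 1) * m * c i)"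
      unfolding r_def by (intro sum.cong) (auto simp: algebra_simps)
    also have "\<dots> = (\<Sum>i\<in>I. a i powr p * c i) - m powr p * F
        - p * m powr (p - 1) * (F * m) + p * m powr (p - 1) * m * F"
      by (simp add: sum.distrib sum_subtractf sum_distrib_left[symmetric] F_def[symmetric] Fm)
    finally have "(\<Sum>i\<in>I. a i powr p * c i) = (\<Sum>i\<in>I. r i) + m powr p * F" by simp
    moreover have "F powr (p - 1) * (m powr p * F) = (F * m) powr p"
      using that m0 powr_mult_base[of F "p - 1"] by (simp add: powr_mult mult_ac)
    ultimately show ?thesis unfolding Fm F_def[symmetric] by (simp add: distrib_left)
  qed
  have F_zero: "c i = 0" if "\<not> F > 0" "i \<in> I" for i
    using that F0 c sum_nonneg_eq_0_iff[OF I, of c] by (auto simp: F_def)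
  show "(\<Sum>i\<in>I. a i * c i) powr p \<le> (\<Sum>i\<in>I. c i) powr (p - 1) * (\<Sum>i\<in>I. a i powr p * c i)"
  proof (cases "F > 0")
    case True
    have "0 \<le> F powr (p - 1) * (\<Sum>i\<in>I. r i)" using r0 by (intro mult_nonneg_nonneg sum_nonneg) auto
    then show ?thesis using main[OF True] by simp
  qed (use F_zero in simp)
  show "a i = a j"
    if eq: "(\<Sum>i\<in>I. a i * c i) powr p = (\<Sum>i\<in>I. c i) powr (p - 1) * (\<Sum>i\<in>I. a i powr p * c i)"
      and ij: "i \<in> I" "j \<in> I" "0 < c i" "0 < c j"
  proof -
    have F: "F > 0" using F_zero[of i] ij by force
    then have "(\<Sum>i\<in>I. r i) = 0" using main eq by simp
    then have "\<forall>i\<in>I. r i = 0" using sum_nonneg_eq_0_iff[OF I, of r] r0 by blast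
    then have "a k = m" if "k \<in> I" "0 < c k" for k
      using that powr_above_tangent(2)[OF p m0 a[OF that(1)]] by (force simp: r_def)
    then show ?thesis using ij by simp
  qed
qed

lemma phi_nth_mult_self:
  assumes "p > 1"
  shows "phi p x $ v * x $ v = \<bar>x $ v\<bar> powr p"
proof -
  have "phi p x $ v * x $ v = \<bar>x $ v\<bar> * \<bar>x $ v\<bar> powr (p - 1)"
    by (simp add: phi_def abs_sgn mult_ac)
  also have "\<dots> = \<bar>x $ v\<bar> powr p" by (simp add: powr_mult_base)
  finally show ?thesis .
qed

lemma phi_nth_mult_le: "phi p x $ v * y \<le> \<bar>x $ v\<bar> powr (p - 1) * \<bar>y\<bar>"
proof -
  have "sgn (x $ v) * y \<le> \<bar>y\<bar>" by (auto simp: sgn_if)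
  then show ?thesis unfolding phi_def by (simp add: mult.assoc mult_left_mono)
qed

lemma phi_uminus: "phi p (- x) = - phi p x"
  by (simp add: phi_def vec_eq_iff)

lemma diag_mat_mult_nth: "(diag_mat \<mu> *v y) $ v = \<mu> v * y $ v"
  by (simp add: matrix_vector_mult_def diag_mat_def if_distrib[of "\<lambda>t. t * _"] cong: if_cong)

section \<open>Mass, energy and eigenpairs\<close>

locale connected_submodular_hypergraph = submodular_hypergraph E \<theta> w \<mu>
  for E :: "'n::finite set set" and \<theta> w \<mu> +
  fixes p :: real
  assumes p_gt_1: "p > 1"
    and connected: "connected_hypergraph E \<theta> w"
begin

abbreviation mass :: "real ^ 'n \<Rightarrow> real" where
  "mass x \<equiv> (\<Sum>v\<in>UNIV. \<mu> v * \<bar>x $ v\<bar> powr p)"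

abbreviation energy :: "real ^ 'n \<Rightarrow> real" where
  "energy x \<equiv> Q_form E \<theta> w p x"

text \<open>Up to the factor \<open>p\<close>, the derivative of \<open>mass\<close> at
  \<open>x\<close> in the direction \<open>z\<close>.\<close>

abbreviation pairing :: "real ^ 'n \<Rightarrow> real ^ 'n \<Rightarrow> real" where
  "pairing x z \<equiv> (\<Sum>v\<in>UNIV. \<mu> v * phi p x $ v * z $ v)"

lemma pairing_self: "pairing x x = mass x"
  by (simp add: mult.assoc phi_nth_mult_self[OF p_gt_1])

lemma weight_nonneg: "0 \<le> \<mu> v"
  using vertex_weight_pos by (rule less_imp_le)

lemma scale_nonneg: "e \<in> E \<Longrightarrow> 0 \<le> \<theta> e"
  using scale_pos by (rule less_imp_le)

lemma mass_pos: "x \<noteq> 0 \<Longrightarrow> 0 < mass x"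
proof -
  assume "x \<noteq> 0"
  then obtain v where "x $ v \<noteq> 0" by (auto simp: vec_eq_iff)
  then have "0 < \<mu> v * \<bar>x $ v\<bar> powr p" using vertex_weight_pos by simp
  then show ?thesis
    by (intro sum_pos2[of _ v]) (auto simp: weight_nonneg)
qed

lemma energy_nonneg: "0 \<le> energy x"
  unfolding Q_form_def by (intro sum_nonneg mult_nonneg_nonneg scale_nonneg) auto

lemma energy_uminus: "energy (- x) = energy x"
  unfolding Q_form_def using lovasz_uminus by simp

lemma energy_scaleR: "energy (c *\<^sub>R x) = \<bar>c\<bar> powr p * energy x"
  unfolding Q_form_def using lovasz_scaleR lovasz_nonneg
  by (simp add: sum_distrib_left powr_mult mult_ac)

lemma mass_scaleR: "mass (c *\<^sub>R x) = \<bar>c\<bar> powr p * mass x"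
  by (simp add: sum_distrib_left powr_mult abs_mult mult_ac)

lemma zero_boundary_imp_UNIV:
  assumes "\<And>e. e \<in> E \<Longrightarrow> cut e S = 0" and "S \<noteq> {}"
  shows "S = UNIV"
proof (rule ccontr)
  assume "S \<noteq> UNIV"
  then have "S \<noteq> {} \<and> S \<subset> UNIV" using assms(2) by (simp add: psubset_eq)
  then have "vol_boundary E \<theta> w S > 0"
    by (rule connected[unfolded connected_hypergraph_def, rule_format])
  then show False using assms(1) by (simp add: vol_boundary_def)
qed

text \<open>Connectedness is stated through cuts, here it is needed for the adjacency graph. In each
  hyperedge a set without outgoing adjacencies is separated from its complement by a zero set, so
  its own boundary vanishes.\<close>

lemma closed_under_adjacency:
  assumes R: "\<And>a b. a \<in> R \<Longrightarrow> (a, b) \<in> adjacency E w \<Longrightarrow> b \<in> R" and "R \<noteq> {}"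
  shows "R = UNIV"
proof (rule zero_boundary_imp_UNIV[OF _ assms(2)])
  fix e assume e: "e \<in> E"
  have "\<exists>Z. cut e Z = 0 \<and> R \<inter> e \<subseteq> Z \<and> Z \<inter> (- R \<inter> e) = {}"
    using R by (intro zero_set_separation[OF e] nonadjacent_zero_set[OF e]) auto
  then obtain Z where "cut e Z = 0" "R \<inter> e \<subseteq> Z" "Z \<inter> (- R \<inter> e) = {}" by blast
  moreover from this have "Z \<inter> e = R \<inter> e" by blast
  ultimately show "cut e R = 0" by simp
qed

text \<open>The weak form of the eigenvalue equation: one maximizer is selected per hyperedge, and
  the inclusion is tested against arbitrary vectors \<open>z\<close>.\<close>

lemma eigenpairE:
  assumes "eigenpair E \<theta> w \<mu> p l x"
  obtains u where "\<And>e. e \<in> E \<Longrightarrow> u e \<in> lovasz_subdiff w e x"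
    "\<And>z. l * pairing x z = (\<Sum>e\<in>E. \<theta> e * lovasz_ext w e x powr (p - 1) * (u e \<bullet> z))"
proof -
  have "l *\<^sub>R (diag_mat \<mu> *v phi p x) \<in> (\<Sum>e\<in>E. (\<lambda>y. (\<theta> e * lovasz_ext w e x powr (p - 1)) *\<^sub>R y) ` lovasz_subdiff w e x)"
    using assms by (simp add: eigenpair_def p_laplacian_def)
  then obtain s where s: "l *\<^sub>R (diag_mat \<mu> *v phi p x) = sum s E"
    "\<And>e. e \<in> E \<Longrightarrow> s e \<in> (\<lambda>y. (\<theta> e * lovasz_ext w e x powr (p - 1)) *\<^sub>R y) ` lovasz_subdiff w e x"
    by (auto simp: set_sum_alt[OF finite])
  then have "\<exists>y. y \<in> lovasz_subdiff w e x \<and> s e = (\<theta> e * lovasz_ext w e x powr (p - 1)) *\<^sub>R y" if "e \<in> E" for e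
    using that by blast
  then obtain u where u: "\<And>e. e \<in> E \<Longrightarrow> u e \<in> lovasz_subdiff w e x"
      "\<And>e. e \<in> E \<Longrightarrow> s e = (\<theta> e * lovasz_ext w e x powr (p - 1)) *\<^sub>R u e"
    by metis
  have "l * pairing x z = (\<Sum>e\<in>E. \<theta> e * lovasz_ext w e x powr (p - 1) * (u e \<bullet> z))" for z
  proof -
    have "l * pairing x z = (l *\<^sub>R (diag_mat \<mu> *v phi p x)) \<bullet> z"
      by (simp add: inner_vec_def diag_mat_mult_nth sum_distrib_left mult_ac)
    also have "\<dots> = (\<Sum>e\<in>E. s e \<bullet> z)" by (simp add: s(1) inner_sum_left)
    finally show ?thesis by (simp add: u(2))
  qed
  then show thesis using that u(1) by blast
qed

lemma eigenpair_uminus: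
  assumes "eigenpair E \<theta> w \<mu> p l x"
  shows "eigenpair E \<theta> w \<mu> p l (- x)"
proof -
  obtain u where u: "\<And>e. e \<in> E \<Longrightarrow> u e \<in> lovasz_subdiff w e x"
    "\<And>z. l * pairing x z = (\<Sum>e\<in>E. \<theta> e * lovasz_ext w e x powr (p - 1) * (u e \<bullet> z))"
    using eigenpairE[OF assms] by blast
  let ?s = "\<lambda>e. (\<theta> e * lovasz_ext w e (- x) powr (p - 1)) *\<^sub>R (- u e)"
  have "l *\<^sub>R (diag_mat \<mu> *v phi p (- x)) = sum ?s E"
  proof (rule vector_eq_rdot[THEN iffD1], rule allI)
    fix z
    have "(l *\<^sub>R (diag_mat \<mu> *v phi p (- x))) \<bullet> z = - (l * pairing x z)"
      by (simp add: inner_vec_def diag_mat_mult_nth sum_distrib_left phi_uminus sum_negf mult_ac)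
    also have "\<dots> = sum ?s E \<bullet> z"
      unfolding u(2) by (simp add: inner_sum_left sum_negf lovasz_uminus)
    finally show "(l *\<^sub>R (diag_mat \<mu> *v phi p (- x))) \<bullet> z = sum ?s E \<bullet> z" .
  qed
  moreover have "- u e \<in> lovasz_subdiff w e (- x)" if "e \<in> E" for e
    using subdiff_uminus[OF that u(1)[OF that]] .
  ultimately have "l *\<^sub>R (diag_mat \<mu> *v phi p (- x)) \<in> p_laplacian E \<theta> w p (- x)"
    unfolding p_laplacian_def set_sum_alt[OF finite] by blast
  moreover have "- x \<noteq> 0" using assms by (simp add: eigenpair_def)
  ultimately show ?thesis by (simp add: eigenpair_def)
qed

text \<open>If \<open>x\<close> vanished on \<open>C\<close>, testing the eigenvalue equation with
  the indicator of \<open>C\<close> would give 0 on the left. Since \<open>C\<close> is tight, the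
  right side is a sum of nonnegative multiples of cuts of \<open>C\<close>. All these cuts would
  vanish, and connectedness would give \<open>C = UNIV\<close> and \<open>x = 0\<close>.\<close>

lemma weak_component_meets_support:
  assumes x: "eigenpair E \<theta> w \<mu> p l x" and C: "C \<in> conn_components E w {v. 0 \<le> x $ v}"
  shows "\<exists>v\<in>C. 0 < x $ v"
proof (rule ccontr)
  assume "\<not> ?thesis"
  then have C0: "x $ v = 0" if "v \<in> C" for v
    using that component_subset[OF C] by (force simp: not_less)
  obtain u where u: "\<And>e. e \<in> E \<Longrightarrow> u e \<in> lovasz_subdiff w e x"
    "\<And>z. l * pairing x z = (\<Sum>e\<in>E. \<theta> e * lovasz_ext w e x powr (p - 1) * (u e \<bullet> z))"
    using eigenpairE[OF x] by blast
  have tight: "tight e y C" if e: "e \<in> E" and y: "y \<in> lovasz_subdiff w e x" for e y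
  proof -
    have "tight e y ({v. 0 \<le> x $ v} \<inter> C)"
      by (rule tight_component[OF e subdiff_base[OF e y] C])
        (auto intro!: tight_upper_set[OF e y])
    then show ?thesis using component_subset[OF C] by (simp add: Int_absorb1)
  qed
  have "pairing x (restr 1 C) = 0"
    using C0 by (intro sum.neutral) (auto simp: phi_def)
  then have "(\<Sum>e\<in>E. \<theta> e * lovasz_ext w e x powr (p - 1) * cut e C) = 0"
    using u(2)[of "restr 1 C"] tight u(1) by (simp flip: sum_vec_eq_inner)
  then have zero: "\<theta> e * lovasz_ext w e x powr (p - 1) * cut e C = 0" if "e \<in> E" for e
    using that sum_nonneg_eq_0_iff[of E "\<lambda>e. \<theta> e * lovasz_ext w e x powr (p - 1) * cut e C"]
      scale_nonneg cut_nonneg by simp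
  \<comment> \<open>A hyperedge on which the Lovasz extension of \<open>x\<close> vanishes drops out
    of the sum; there 0 is a maximizer, and its tightness on \<open>C\<close> gives the cut.\<close>
  have "cut e C = 0" if e: "e \<in> E" for e
  proof (cases "lovasz_ext w e x = 0")
    case True
    show ?thesis using tight[OF e zero_subdiff[OF e True]] by simp
  next
    case False
    then show ?thesis using zero[OF e] scale_pos[OF e] by simp
  qed
  then have "C = UNIV"
    by (rule zero_boundary_imp_UNIV[OF _ component_nonempty[OF C]])
  then have "x = 0" using C0 by (simp add: vec_eq_iff)
  then show False using x by (simp add: eigenpair_def)
qed

text \<open>What the energy estimate and the genus bound need from strong and weak domains alike.
  Overlaps at zeros of \<open>x\<close> are allowed because weak domains of opposite sign may share
  them.\<close>

definition nodal_family :: "real ^ 'n \<Rightarrow> 'n set set \<Rightarrow> bool" where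
  "nodal_family x \<D> \<longleftrightarrow>
    (\<forall>D\<in>\<D>. \<forall>D'\<in>\<D>. \<forall>v. v \<in> D \<longrightarrow> v \<in> D' \<longrightarrow> D \<noteq> D' \<longrightarrow> x $ v = 0) \<and>
    (\<forall>D\<in>\<D>. restr x D \<noteq> 0) \<and>
    (\<forall>v. x $ v \<noteq> 0 \<longrightarrow> (\<exists>D\<in>\<D>. v \<in> D)) \<and>
    (\<forall>D\<in>\<D>. \<forall>e\<in>E. \<forall>u\<in>lovasz_subdiff w e x. u \<bullet> restr x D = lovasz_ext w e (restr x D))"

text \<open>\<open>A\<close> and \<open>B\<close> stand for the strict or the non-strict sign sets
  of \<open>x\<close>. The negative half is the positive half for \<open>- x\<close>, where
  \<open>- u\<close> is a maximizer.\<close>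

lemma nodal_family_signed:
  assumes \<D>: "\<D> = conn_components E w A \<union> conn_components E w B"
    and A: "\<And>v. v \<in> A \<Longrightarrow> 0 \<le> x $ v" "\<And>a b. a \<in> A \<Longrightarrow> b \<notin> A \<Longrightarrow> x $ b < x $ a"
    and B: "\<And>v. v \<in> B \<Longrightarrow> x $ v \<le> 0" "\<And>a b. a \<in> B \<Longrightarrow> b \<notin> B \<Longrightarrow> x $ a < x $ b"
    and cover: "\<And>v. x $ v \<noteq> 0 \<Longrightarrow> v \<in> A \<union> B"
    and nz: "\<And>D. D \<in> \<D> \<Longrightarrow> \<exists>v\<in>D. x $ v \<noteq> 0"
  shows "nodal_family x \<D>"
  unfolding nodal_family_def
proof (intro conjI ballI allI impI)
  fix D D' v assume "D \<in> \<D>" "D' \<in> \<D>" "v \<in> D" "v \<in> D'" "D \<noteq> D'"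
  then have "v \<in> A \<and> v \<in> B"
    using components_disjoint[of D _ D' v] component_subset unfolding \<D> by blast
  then show "x $ v = 0" using A(1) B(1) by force
next
  fix D assume "D \<in> \<D>"
  then obtain v where "v \<in> D" "x $ v \<noteq> 0" using nz by blast
  then have "restr x D $ v \<noteq> 0" by simp
  then show "restr x D \<noteq> 0" by (metis zero_index)
next
  fix v assume "x $ v \<noteq> 0"
  then show "\<exists>D\<in>\<D>. v \<in> D" using cover component_cover unfolding \<D> by (metis Un_iff)
next
  fix D e u assume D: "D \<in> \<D>" and e: "e \<in> E" and u: "u \<in> lovasz_subdiff w e x"
  show "u \<bullet> restr x D = lovasz_ext w e (restr x D)"
  proof (cases "D \<in> conn_components E w A")
    case True
    show ?thesis by (rule inner_restr_component[OF e u True A])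
  next
    case False
    then have "D \<in> conn_components E w B" using D \<D> by blast
    then have "(- u) \<bullet> restr (- x) D = lovasz_ext w e (restr (- x) D)"
      by (rule inner_restr_component[OF e subdiff_uminus[OF e u]]) (use B in auto)
    then show ?thesis by (simp add: restr_uminus lovasz_uminus[OF e])
  qed
qed

lemma nodal_family_strong: "nodal_family x (strong_nodal_domains E w x)"
proof (rule nodal_family_signed[OF strong_nodal_domains_def])
  fix D assume "D \<in> strong_nodal_domains E w x"
  then show "\<exists>v\<in>D. x $ v \<noteq> 0"
    unfolding strong_nodal_domains_def using component_subset component_nonempty by fastforce
qed auto

lemma weak_domain_cases:
  assumes x: "eigenpair E \<theta> w \<mu> p l x" and D: "D \<in> weak_nodal_domains E w x"
  obtains "D \<in> conn_components E w {v. 0 \<le> x $ v}" "\<exists>v\<in>D. 0 < x $ v"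
  | "D \<in> conn_components E w {v. x $ v \<le> 0}" "\<exists>v\<in>D. x $ v < 0"
  using D weak_component_meets_support[OF x, of D] weak_component_meets_support[OF eigenpair_uminus[OF x], of D]
  unfolding weak_nodal_domains_def by auto

lemma nodal_family_weak:
  assumes "eigenpair E \<theta> w \<mu> p l x"
  shows "nodal_family x (weak_nodal_domains E w x)"
proof (rule nodal_family_signed[OF weak_nodal_domains_def])
  fix D assume "D \<in> weak_nodal_domains E w x"
  then show "\<exists>v\<in>D. x $ v \<noteq> 0"
    using weak_domain_cases[OF assms] by (metis less_irrefl)
qed auto

section \<open>Combinations of the restrictions to nodal domains\<close>

definition comb :: "real ^ 'n \<Rightarrow> 'n set set \<Rightarrow> ('n set \<Rightarrow> real) \<Rightarrow> real ^ 'n" where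
  "comb x \<D> \<alpha> = (\<Sum>D\<in>\<D>. \<alpha> D *\<^sub>R restr x D)"

lemma restr_nth_zero: "x $ v = 0 \<Longrightarrow> restr x D $ v = 0"
  by simp

lemma comb_nth_zero: "x $ v = 0 \<Longrightarrow> comb x \<D> \<alpha> $ v = 0"
  by (simp add: comb_def restr_nth_zero del: restr_nth)

lemma sum_nodal:
  fixes g :: "'n set \<Rightarrow> real"
  assumes F: "nodal_family x \<D>" and D: "D \<in> \<D>" "v \<in> D" and v: "x $ v \<noteq> 0"
    and g: "\<And>D'. D' \<in> \<D> \<Longrightarrow> v \<notin> D' \<Longrightarrow> g D' = 0"
  shows "(\<Sum>D\<in>\<D>. g D) = g D"
proof -
  have "(\<Sum>D'\<in>\<D>. g D') = (\<Sum>D'\<in>\<D>. if D' = D then g D else 0)"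
    using F D v g unfolding nodal_family_def by (intro sum.cong) auto
  then show ?thesis using D by simp
qed

lemma comb_nth:
  assumes F: "nodal_family x \<D>" and D: "D \<in> \<D>" "v \<in> D"
  shows "comb x \<D> \<alpha> $ v = \<alpha> D * x $ v"
proof (cases "x $ v = 0")
  case True
  then show ?thesis by (simp add: comb_nth_zero)
next
  case False
  show ?thesis
    unfolding comb_def using sum_nodal[OF F D False, of "\<lambda>D. \<alpha> D * restr x D $ v"] D by simp
qed

lemma comb_one:
  assumes F: "nodal_family x \<D>"
  shows "comb x \<D> (\<lambda>_. 1) = x"
proof -
  have "comb x \<D> (\<lambda>_. 1) $ v = x $ v" for v
  proof (cases "x $ v = 0")
    case False
    then obtain D where "D \<in> \<D>" "v \<in> D" using F unfolding nodal_family_def by blast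
    then show ?thesis using comb_nth[OF F, of D v] by simp
  qed (simp add: comb_nth_zero)
  then show ?thesis by (simp add: vec_eq_iff)
qed

lemma mass_comb:
  assumes F: "nodal_family x \<D>"
  shows "mass (comb x \<D> \<alpha>) = (\<Sum>D\<in>\<D>. \<bar>\<alpha> D\<bar> powr p * mass (restr x D))"
proof -
  have "\<bar>comb x \<D> \<alpha> $ v\<bar> powr p = (\<Sum>D\<in>\<D>. \<bar>\<alpha> D\<bar> powr p * \<bar>restr x D $ v\<bar> powr p)" for v
  proof (cases "x $ v = 0")
    case True
    then show ?thesis by (simp add: comb_nth_zero restr_nth_zero del: restr_nth)
  next
    case False
    then obtain D where D: "D \<in> \<D>" "v \<in> D" using F unfolding nodal_family_def by blast
    show ?thesis
      using sum_nodal[OF F D False, of "\<lambda>D. \<bar>\<alpha> D\<bar> powr p * \<bar>restr x D $ v\<bar> powr p"] D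
      by (simp add: comb_nth[OF F D] abs_mult powr_mult)
  qed
  then have "mass (comb x \<D> \<alpha>) = (\<Sum>v\<in>UNIV. \<Sum>D\<in>\<D>. \<bar>\<alpha> D\<bar> powr p * (\<mu> v * \<bar>restr x D $ v\<bar> powr p))"
    by (simp only: sum_distrib_left mult_ac)
  also have "\<dots> = (\<Sum>D\<in>\<D>. \<bar>\<alpha> D\<bar> powr p * mass (restr x D))"
    by (subst sum.swap) (simp only: sum_distrib_left)
  finally show ?thesis .
qed

lemma lovasz_comb_le:
  assumes "e \<in> E"
  shows "lovasz_ext w e (comb x \<D> \<alpha>) \<le> (\<Sum>D\<in>\<D>. \<bar>\<alpha> D\<bar> * lovasz_ext w e (restr x D))"
  unfolding comb_def using lovasz_sum_le[OF assms finite, of "\<lambda>D. \<alpha> D *\<^sub>R restr x D" \<D>]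
  by (simp add: lovasz_scaleR[OF assms])

text \<open>A single maximizer for \<open>x\<close> attains the values at all restrictions
  simultaneously, so subadditivity is an equality here.\<close>

lemma sum_lovasz_restr:
  assumes F: "nodal_family x \<D>" and e: "e \<in> E"
  shows "(\<Sum>D\<in>\<D>. lovasz_ext w e (restr x D)) = lovasz_ext w e x"
proof -
  obtain u where u: "u \<in> lovasz_subdiff w e x" using lovasz_subdiffE[OF e] by blast
  have "(\<Sum>D\<in>\<D>. lovasz_ext w e (restr x D)) = (\<Sum>D\<in>\<D>. u \<bullet> restr x D)"
    using F e u unfolding nodal_family_def by (intro sum.cong) auto
  also have "\<dots> = u \<bullet> comb x \<D> (\<lambda>_. 1)" by (simp add: comb_def inner_sum_right)
  also have "\<dots> = lovasz_ext w e x" using u by (simp add: comb_one[OF F] lovasz_subdiff_iff[OF e])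
  finally show ?thesis .
qed

lemma eigenvalue_mass_restr:
  assumes x: "eigenpair E \<theta> w \<mu> p l x" and F: "nodal_family x \<D>" and D: "D \<in> \<D>"
  shows "l * mass (restr x D) = (\<Sum>e\<in>E. \<theta> e * lovasz_ext w e x powr (p - 1) * lovasz_ext w e (restr x D))"
proof -
  obtain u where u: "\<And>e. e \<in> E \<Longrightarrow> u e \<in> lovasz_subdiff w e x"
    "\<And>z. l * pairing x z = (\<Sum>e\<in>E. \<theta> e * lovasz_ext w e x powr (p - 1) * (u e \<bullet> z))"
    using eigenpairE[OF x] by blast
  have "pairing x (restr x D) = mass (restr x D)"
    by (rule sum.cong) (auto simp: mult.assoc phi_nth_mult_self[OF p_gt_1])
  moreover have "u e \<bullet> restr x D = lovasz_ext w e (restr x D)" if "e \<in> E" for e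
    using F D u(1)[OF that] that unfolding nodal_family_def by blast
  ultimately show ?thesis using u(2)[of "restr x D"] by simp
qed

lemma eigenvalue_nonneg:
  assumes x: "eigenpair E \<theta> w \<mu> p l x"
  shows "0 \<le> l"
proof -
  obtain u where u: "\<And>e. e \<in> E \<Longrightarrow> u e \<in> lovasz_subdiff w e x"
    "\<And>z. l * pairing x z = (\<Sum>e\<in>E. \<theta> e * lovasz_ext w e x powr (p - 1) * (u e \<bullet> z))"
    using eigenpairE[OF x] by blast
  have "l * mass x = (\<Sum>e\<in>E. \<theta> e * lovasz_ext w e x powr (p - 1) * (u e \<bullet> x))"
    using u(2)[of x] by (simp add: pairing_self)
  moreover have "u e \<bullet> x = lovasz_ext w e x" if "e \<in> E" for e
    using u(1)[OF that] by (simp add: lovasz_subdiff_iff[OF that])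
  ultimately have "0 \<le> l * mass x"
    using scale_nonneg lovasz_nonneg by (simp add: sum_nonneg)
  moreover have "0 < mass x" using mass_pos x by (simp add: eigenpair_def)
  ultimately show ?thesis using zero_le_mult_iff[of l "mass x"] by linarith
qed

text \<open>In each hyperedge subadditivity is followed by the power mean inequality with the
  extensions of the restrictions as weights. The resulting bounds add up to the right side by
  \<open>eigenvalue_mass_restr\<close>. Equality of the sums forces equality in every hyperedge, and
  then the equality case of the power mean applies.\<close>

lemma energy_comb:
  assumes x: "eigenpair E \<theta> w \<mu> p l x" and F: "nodal_family x \<D>"
  shows "energy (comb x \<D> \<alpha>) \<le> l * mass (comb x \<D> \<alpha>)"
    and "\<lbrakk>energy (comb x \<D> \<alpha>) = l * mass (comb x \<D> \<alpha>); e \<in> E; D \<in> \<D>; D' \<in> \<D>;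
      0 < lovasz_ext w e (restr x D); 0 < lovasz_ext w e (restr x D')\<rbrakk> \<Longrightarrow> \<bar>\<alpha> D\<bar> = \<bar>\<alpha> D'\<bar>"
proof -
  let ?c = "\<lambda>e D. lovasz_ext w e (restr x D)"
  let ?a = "\<lambda>D. \<bar>\<alpha> D\<bar>"
  let ?A = "\<lambda>e. \<theta> e * lovasz_ext w e (comb x \<D> \<alpha>) powr p"
  let ?M = "\<lambda>e. (\<Sum>D\<in>\<D>. ?a D * ?c e D) powr p"
  let ?B = "\<lambda>e. \<theta> e * (lovasz_ext w e x powr (p - 1) * (\<Sum>D\<in>\<D>. ?a D powr p * ?c e D))"
  have l: "l * mass (comb x \<D> \<alpha>) = (\<Sum>e\<in>E. ?B e)"
  proof -
    have "l * mass (comb x \<D> \<alpha>) = (\<Sum>D\<in>\<D>. l * (?a D powr p * mass (restr x D)))"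
      unfolding mass_comb[OF F] by (rule sum_distrib_left)
    also have "\<dots> = (\<Sum>D\<in>\<D>. ?a D powr p * (l * mass (restr x D)))"
      by (rule sum.cong[OF refl mult.left_commute])
    also have "\<dots> = (\<Sum>D\<in>\<D>. \<Sum>e\<in>E. \<theta> e * (lovasz_ext w e x powr (p - 1) * (?a D powr p * ?c e D)))"
    proof (rule sum.cong[OF refl])
      fix D assume D: "D \<in> \<D>"
      show "?a D powr p * (l * mass (restr x D))
          = (\<Sum>e\<in>E. \<theta> e * (lovasz_ext w e x powr (p - 1) * (?a D powr p * ?c e D)))"
        unfolding eigenvalue_mass_restr[OF x F D] by (simp add: sum_distrib_left mult_ac)
    qed
    also have "\<dots> = (\<Sum>e\<in>E. ?B e)"
      by (subst sum.swap) (simp only: sum_distrib_left)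
    finally show ?thesis .
  qed
  have 1: "lovasz_ext w e (comb x \<D> \<alpha>) powr p \<le> ?M e" if "e \<in> E" for e
    using lovasz_comb_le[OF that, of x \<D> \<alpha>] lovasz_nonneg[OF that] p_gt_1 by (intro powr_mono2) auto
  have 2: "?M e \<le> lovasz_ext w e x powr (p - 1) * (\<Sum>D\<in>\<D>. ?a D powr p * ?c e D)" if "e \<in> E" for e
    using weighted_power_mean(1)[OF p_gt_1 finite, of \<D> "?c e" ?a] lovasz_nonneg[OF that]
    by (simp add: sum_lovasz_restr[OF F that])
  have AB: "?A e \<le> ?B e" if "e \<in> E" for e
    using order_trans[OF 1 2, OF that that] scale_pos[OF that] by (intro mult_left_mono) auto
  then show "energy (comb x \<D> \<alpha>) \<le> l * mass (comb x \<D> \<alpha>)"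
    unfolding l Q_form_def by (rule sum_mono)
  show "?a D = ?a D'" if eq: "energy (comb x \<D> \<alpha>) = l * mass (comb x \<D> \<alpha>)" and e: "e \<in> E"
    and D: "D \<in> \<D>" "D' \<in> \<D>" "0 < ?c e D" "0 < ?c e D'"
  proof -
    have "?A e = ?B e"
      using sum_mono_inv[of ?A E ?B e] eq AB e by (simp add: l Q_form_def)
    then have "lovasz_ext w e (comb x \<D> \<alpha>) powr p = lovasz_ext w e x powr (p - 1) * (\<Sum>D\<in>\<D>. ?a D powr p * ?c e D)"
      using scale_pos[OF e] by simp
    then have "?M e = (\<Sum>D\<in>\<D>. ?c e D) powr (p - 1) * (\<Sum>D\<in>\<D>. ?a D powr p * ?c e D)"
      using 1[OF e] 2[OF e] by (simp add: sum_lovasz_restr[OF F e])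
    then show ?thesis
      using weighted_power_mean(2)[OF p_gt_1 finite, of \<D> "?c e" ?a D D'] lovasz_nonneg[OF e] D by simp
  qed
qed

end

section \<open>Descent at combinations of weak nodal domains\<close>

context connected_submodular_hypergraph
begin

lemma weak_nodal_domains_uminus: "weak_nodal_domains E w (- x) = weak_nodal_domains E w x"
  by (auto simp: weak_nodal_domains_def)

lemma comb_uminus: "comb x \<D> (\<lambda>D. - \<alpha> D) = - comb x \<D> \<alpha>"
  by (simp add: comb_def sum_negf)

lemma comb_uminus_left: "comb (- x) \<D> \<alpha> = - comb x \<D> \<alpha>"
  by (simp add: comb_def restr_uminus sum_negf)

text \<open>Otherwise the rigidity of the equality case would give coefficient 0 to every domain on
  which the extension is positive in \<open>e\<close>, and the extension of the combination would
  vanish.\<close>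

lemma lovasz_restr_eq_zero:
  assumes x: "eigenpair E \<theta> w \<mu> p l x" and F: "nodal_family x \<D>"
    and eq: "energy (comb x \<D> \<alpha>) = l * mass (comb x \<D> \<alpha>)"
    and e: "e \<in> E" "0 < lovasz_ext w e (comb x \<D> \<alpha>)"
    and D: "D \<in> \<D>" "\<alpha> D = 0"
  shows "lovasz_ext w e (restr x D) = 0"
proof (rule ccontr)
  assume "lovasz_ext w e (restr x D) \<noteq> 0"
  then have pos: "0 < lovasz_ext w e (restr x D)" using lovasz_nonneg[OF e(1), of "restr x D"] by simp
  have "\<bar>\<alpha> D'\<bar> * lovasz_ext w e (restr x D') = 0" if D': "D' \<in> \<D>" for D'
  proof (cases "lovasz_ext w e (restr x D') = 0")
    case False
    then have "0 < lovasz_ext w e (restr x D')" using lovasz_nonneg[OF e(1), of "restr x D'"] by simp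
    then have "\<bar>\<alpha> D\<bar> = \<bar>\<alpha> D'\<bar>" by (rule energy_comb(2)[OF x F eq e(1) D(1) D' pos])
    then show ?thesis using D(2) by simp
  qed simp
  then have "(\<Sum>D'\<in>\<D>. \<bar>\<alpha> D'\<bar> * lovasz_ext w e (restr x D')) = 0" by (rule sum.neutral[OF ballI])
  then show False using lovasz_comb_le[OF e(1), of x \<D> \<alpha>] e(2) by simp
qed

text \<open>
  \<open>C\<close> and \<open>D\<close> are weak nodal domains of opposite sign with \<open>C\<close> switched off; pushing the common
  zeros \<open>C \<inter> D\<close> towards the sign that the combination has on \<open>D\<close> lowers the energy to first order.
\<close>

lemma energy_descent_oriented:
  assumes x: "eigenpair E \<theta> w \<mu> p l x" and \<D>: "\<D> = weak_nodal_domains E w x"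
    and y_def: "y = comb x \<D> \<alpha>" and eq: "energy y = l * mass y"
    and C: "C \<in> conn_components E w {v. 0 \<le> x $ v}" "\<alpha> C = 0"
    and D: "D \<in> conn_components E w {v. x $ v \<le> 0}"
    and v: "v \<in> C" "v \<in> D" and u: "u \<in> D" "x $ u < 0" "0 < y $ u"
    and adj: "(v, u) \<in> adjacency E w"
  shows "\<exists>z. energy z < energy y \<and> pairing y z = mass y"
proof -
  define B where "B = C \<inter> D"
  define T where "T = {b. y $ b \<le> 0}"
  have F: "nodal_family x \<D>" unfolding \<D> by (rule nodal_family_weak[OF x])
  have CD: "C \<in> \<D>" "D \<in> \<D>" using C D by (simp_all add: \<D> weak_nodal_domains_def)
  have xB: "x $ b = 0" if "b \<in> B" for b
    using that component_subset[OF C(1)] component_subset[OF D] by (force simp: B_def)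
  have yB: "y $ b = 0" if "b \<in> B" for b using xB[OF that] by (simp add: y_def comb_nth_zero)
  have yD: "y $ b = \<alpha> D * x $ b" if "b \<in> D" for b
    unfolding y_def by (rule comb_nth[OF F CD(2) that])
  have \<alpha>D: "\<alpha> D < 0" using yD[OF u(1)] u(2,3) by (simp add: zero_less_mult_iff)
  have uB: "u \<notin> B" using xB u(2) by force
  have vB: "v \<in> B" using v by (simp add: B_def)
  obtain e0 where e0: "e0 \<in> E" "\<And>S. v \<in> S \<Longrightarrow> u \<notin> S \<Longrightarrow> 0 < cut e0 S" "\<And>S. u \<in> S \<Longrightarrow> v \<notin> S \<Longrightarrow> 0 < cut e0 S"
    using adjacency_cut_pos[OF adj] by blast
  \<comment> \<open>A zero set carves \<open>B\<close> out of the nonpositive set \<open>T\<close>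
    of \<open>y\<close>. The only adjacent pairs to separate lead from \<open>B\<close> to a vertex
    \<open>c\<close> of \<open>C\<close> with \<open>x\<close> positive: where \<open>x\<close> is
    negative, \<open>c\<close> lies in \<open>D\<close> and \<open>y\<close> is positive there.
    Since \<open>C\<close> is switched off, its restriction has extension 0 in \<open>e\<close>, so
    its positive set has zero cut.\<close>
  have Z: "\<exists>Z. cut e Z = 0 \<and> T \<inter> Z \<inter> e = B \<inter> e" if e: "e \<in> E" "0 < lovasz_ext w e y" for e
  proof -
    have "\<exists>Z. cut e Z = 0 \<and> B \<inter> e \<subseteq> Z \<and> Z \<inter> ((T - B) \<inter> e) = {}"
    proof (rule zero_set_separation[OF e(1)])
      fix a c assume a: "a \<in> B \<inter> e" and c: "c \<in> (T - B) \<inter> e"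
      show "\<exists>Z. cut e Z = 0 \<and> a \<in> Z \<and> c \<notin> Z"
      proof (cases "(a, c) \<in> adjacency E w")
        case False
        then show ?thesis using nonadjacent_zero_set[OF e(1)] a c by blast
      next
        case True
        have aCD: "a \<in> C" "a \<in> D" using a by (auto simp: B_def)
        have cC: "c \<in> C" if "0 \<le> x $ c" using component_closed[OF C(1) aCD(1) _ True] that by simp
        have cD: "c \<in> D" if "x $ c \<le> 0" using component_closed[OF D aCD(2) _ True] that by simp
        have "x $ c \<noteq> 0" using cC cD c by (auto simp: B_def)
        moreover have "\<not> x $ c < 0"
        proof
          assume "x $ c < 0"
          then have "0 < y $ c" using yD[OF cD] \<alpha>D by (simp add: mult_neg_neg)
          then show False using c by (simp add: T_def)
        qed
        ultimately have xc: "0 < x $ c" by simp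
        have "lovasz_ext w e (restr x C) = 0"
          by (rule lovasz_restr_eq_zero[OF x F eq[unfolded y_def] e[unfolded y_def] CD(1) C(2)])
        then have "cut e (- {b. 0 < restr x C $ b}) = 0"
          unfolding cut_Compl[OF e(1)] by (rule lovasz_zero_cut[OF e(1)])
        moreover have "a \<in> - {b. 0 < restr x C $ b}" using xB a by simp
        moreover have "c \<notin> - {b. 0 < restr x C $ b}" using xc cC by simp
        ultimately show ?thesis by blast
      qed
    qed
    then obtain Z where Z: "cut e Z = 0" "B \<inter> e \<subseteq> Z" "Z \<inter> ((T - B) \<inter> e) = {}" by blast
    have "B \<subseteq> T" using yB by (auto simp: T_def)
    then have "T \<inter> Z \<inter> e = B \<inter> e" using Z(2,3) by blast
    then show ?thesis using Z(1) by blast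
  qed
  \<comment> \<open>Raising \<open>B\<close> from the value 0 by less than the least positive value
    of \<open>y\<close> keeps \<open>- T\<close> strictly above \<open>T\<close>, so
    \<open>- T\<close> is tight for maximizers at the raised point.\<close>
  define m where "m = Min {y $ b |b. 0 < y $ b}"
  have fin: "finite {y $ b |b. 0 < y $ b}" by simp
  have "m \<in> {y $ b |b. 0 < y $ b}" unfolding m_def using u(3) by (intro Min_in[OF fin]) blast
  then have m0: "0 < m" by auto
  have m: "m \<le> y $ b" if "0 < y $ b" for b unfolding m_def using that by (intro Min_le[OF fin]) blast
  define z where "z t = y + t *\<^sub>R restr 1 B" for t
  \<comment> \<open>For a maximizer \<open>s\<close> at the raised point, \<open>- s\<close> is
    tight on \<open>T\<close> and on the zero set, hence on \<open>B\<close>. So raising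
    \<open>B\<close> lowers the extension at the full rate \<open>cut e B\<close>.\<close>
  have decr: "lovasz_ext w e (z t) \<le> lovasz_ext w e y - t * cut e B"
    if e: "e \<in> E" "0 < lovasz_ext w e y" and t: "0 < t" "t < m" for e t
  proof -
    obtain Z where Z: "cut e Z = 0" "T \<inter> Z \<inter> e = B \<inter> e" using Z[OF e] by blast
    obtain s where s: "s \<in> lovasz_subdiff w e (z t)" using lovasz_subdiffE[OF e(1)] by blast
    note sb = subdiff_base[OF e(1) s]
    note nb = base_uminus[OF e(1) sb]
    have "tight e s (- T)"
    proof (rule tight_upper_set[OF e(1) s])
      fix a b assume "a \<in> - T" "b \<notin> - T"
      then have "t < y $ a" "y $ b \<le> 0" using m[of a] t by (auto simp: T_def)
      then show "z t $ b < z t $ a"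
        using t yB[of b] by (auto simp: z_def)
    qed
    then have "tight e (- s) T"
      using base_sum_Compl[OF sb, of T] cut_Compl[OF e(1), of T] by (simp add: sum_negf)
    then have "tight e (- s) (T \<inter> Z)"
      by (rule tight_Un_Int(2)[OF e(1) nb _ tight_zero_set[OF e(1) nb Z(1)]])
    then have "(\<Sum>b\<in>B. (- s) $ b) = cut e B"
      using base_sum_cong[OF e(1) nb Z(2)] Z(2) by simp
    then have "s \<bullet> restr 1 B = - cut e B" by (simp add: sum_negf sum_vec_eq_inner)
    moreover have "lovasz_ext w e (z t) = s \<bullet> y + t * (s \<bullet> restr 1 B)"
      using s unfolding lovasz_subdiff_iff[OF e(1)] by (simp add: z_def inner_add_right)
    ultimately show ?thesis using lovasz_ge[OF e(1) sb, of y] by simp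
  qed
  \<comment> \<open>\<open>c0\<close> is, up to the factor \<open>p\<close>, a lower bound for the
    first-order gain; it comes from the hyperedges where the extension of \<open>y\<close> is
    positive. \<open>K\<close> bounds the cost of order \<open>t powr p\<close> in the others, which
    is negligible for small \<open>t\<close> since \<open>p > 1\<close>.\<close>
  define c0 where "c0 = (\<Sum>e\<in>E. \<theta> e * lovasz_ext w e y powr (p - 1) * cut e B)"
  define K where "K = (\<Sum>e\<in>E. \<theta> e * lovasz_ext w e (restr 1 B) powr p)"
  have K0: "0 \<le> K" unfolding K_def by (intro sum_nonneg mult_nonneg_nonneg scale_nonneg) auto
  have "0 < lovasz_ext w e0 y"
  proof (rule ccontr)
    assume "\<not> ?thesis"
    then have "lovasz_ext w e0 y = 0" using lovasz_nonneg[OF e0(1), of y] by simp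
    then have "cut e0 {b. 0 < y $ b} = 0" by (rule lovasz_zero_cut[OF e0(1)])
    then show False using e0(3)[of "{b. 0 < y $ b}"] u(3) yB[OF vB] by simp
  qed
  then have "0 < \<theta> e0 * lovasz_ext w e0 y powr (p - 1) * cut e0 B"
    using scale_pos[OF e0(1)] e0(2)[OF vB uB] by simp
  then have c0: "0 < c0"
    unfolding c0_def using e0(1) scale_nonneg cut_nonneg by (intro sum_pos2[OF finite]) auto
  have main: "energy (z t) \<le> energy y - t * c0 + t powr p * K" if t: "0 < t" "t < m" for t
  proof -
    have "\<theta> e * lovasz_ext w e (z t) powr p \<le> \<theta> e * lovasz_ext w e y powr p
        - t * (\<theta> e * lovasz_ext w e y powr (p - 1) * cut e B) + t powr p * (\<theta> e * lovasz_ext w e (restr 1 B) powr p)"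
      if e: "e \<in> E" for e
    proof -
      let ?f = "lovasz_ext w e y" and ?g = "lovasz_ext w e (z t)" and ?h = "lovasz_ext w e (restr 1 B)"
      have "?g powr p \<le> ?f powr p - t * (?f powr (p - 1) * cut e B) + t powr p * ?h powr p"
      proof (cases "0 < ?f")
        case True
        note d = decr[OF e True t]
        have nn: "0 \<le> t * cut e B" using t cut_nonneg[OF e, of B] by simp
        have g0: "0 \<le> ?g" by (rule lovasz_nonneg[OF e])
        have "?g powr p = ?g powr (p - 1) * ?g" using powr_mult_base[OF g0, of "p - 1"] by (simp add: mult.commute)
        also have "\<dots> \<le> ?f powr (p - 1) * (?f - t * cut e B)"
          using d nn g0 p_gt_1 by (intro mult_mono powr_mono2) auto
        also have "\<dots> = ?f powr p - t * (?f powr (p - 1) * cut e B)"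
          using powr_mult_base[of ?f "p - 1"] True by (simp add: algebra_simps)
        finally show ?thesis by (simp add: add_increasing2)
      next
        case False
        then have f0: "?f = 0" using lovasz_nonneg[OF e, of y] by simp
        have "?g \<le> t * ?h"
          using lovasz_add_le[OF e, of y "t *\<^sub>R restr 1 B"] f0 t by (simp add: z_def lovasz_scaleR[OF e])
        then have "?g powr p \<le> (t * ?h) powr p"
          using lovasz_nonneg[OF e] p_gt_1 by (intro powr_mono2) auto
        then show ?thesis using f0 t lovasz_nonneg[OF e] by (simp add: powr_mult)
      qed
      from mult_left_mono[OF this scale_nonneg[OF e]] show ?thesis by (simp add: algebra_simps)
    qed
    then have "energy (z t) \<le> (\<Sum>e\<in>E. \<theta> e * lovasz_ext w e y powr p
        - t * (\<theta> e * lovasz_ext w e y powr (p - 1) * cut e B) + t powr p * (\<theta> e * lovasz_ext w e (restr 1 B) powr p))"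
      unfolding Q_form_def by (rule sum_mono)
    also have "\<dots> = energy y - t * c0 + t powr p * K"
      by (simp add: sum.distrib sum_subtractf Q_form_def c0_def K_def sum_distrib_left)
    finally show ?thesis .
  qed
  \<comment> \<open>The second bound gives \<open>t powr (p - 1) * K < c0\<close>; adding 1 to
    \<open>K\<close> provides strictness and a nonzero denominator.\<close>
  define t where "t = min (m / 2) ((c0 / (K + 1)) powr (1 / (p - 1)))"
  have t: "0 < t" "t < m" using m0 c0 K0 by (auto simp: t_def)
  have "t powr (p - 1) \<le> ((c0 / (K + 1)) powr (1 / (p - 1))) powr (p - 1)"
    using t p_gt_1 by (intro powr_mono2) (auto simp: t_def)
  also have "\<dots> = c0 / (K + 1)" using p_gt_1 c0 K0 by (simp add: powr_powr)
  finally have "t powr (p - 1) * K \<le> c0 / (K + 1) * K" using K0 by (rule mult_right_mono)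
  also have "\<dots> < c0" using c0 K0 by (simp add: field_simps)
  finally have "t * (t powr (p - 1) * K) < t * c0" using t(1) by (rule mult_strict_left_mono)
  moreover have "t powr p = t * t powr (p - 1)" using powr_mult_base[of t "p - 1"] t by simp
  ultimately have "energy (z t) < energy y" using main[OF t] by (simp add: mult.assoc)
  moreover have "pairing y (z t) = mass y"
  proof -
    have *: "\<mu> b * phi p y $ b * z t $ b = \<mu> b * phi p y $ b * y $ b" for b
      using yB[of b] by (cases "b \<in> B") (auto simp: z_def phi_def)
    have "pairing y (z t) = pairing y y" by (intro sum.cong refl *)
    then show ?thesis by (simp only: pairing_self)
  qed
  ultimately show ?thesis by blast
qed

text \<open>An adjacency leading out of a switched-off domain \<open>C\<close> produces the oriented
  situation. The vertex \<open>u\<close> is negative, or it would lie in \<open>C\<close>. If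
  \<open>v\<close> were positive, \<open>C\<close> and the domain \<open>D\<close> of
  \<open>u\<close> would both have positive extension in a common hyperedge, so their coefficients
  would have equal modulus. Hence \<open>v\<close> is a zero and belongs to \<open>D\<close> as
  well. The sign of \<open>y\<close> at \<open>u\<close> is adjusted by negating
  \<open>y\<close>.\<close>

lemma energy_descent_half:
  assumes x: "eigenpair E \<theta> w \<mu> p l x" and \<D>: "\<D> = weak_nodal_domains E w x"
    and y_def: "y = comb x \<D> \<alpha>" and eq: "energy y = l * mass y"
    and C: "C \<in> conn_components E w {v. 0 \<le> x $ v}" "\<alpha> C = 0"
    and v: "v \<in> C" and adj: "(v, u) \<in> adjacency E w"
    and u: "\<And>D. D \<in> \<D> \<Longrightarrow> u \<in> D \<Longrightarrow> \<alpha> D \<noteq> 0"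
  shows "\<exists>z. energy z < energy y \<and> pairing y z = mass y"
proof -
  have F: "nodal_family x \<D>" unfolding \<D> by (rule nodal_family_weak[OF x])
  have C\<D>: "C \<in> \<D>" using C by (simp add: \<D> weak_nodal_domains_def)
  have xu: "x $ u < 0"
  proof (rule ccontr)
    assume "\<not> ?thesis"
    then have "u \<in> C" using component_closed[OF C(1) v _ adj] by simp
    then show False using u[OF C\<D>] C(2) by blast
  qed
  then obtain D where D: "D \<in> conn_components E w {v. x $ v \<le> 0}" "u \<in> D"
    using component_cover[of u "{v. x $ v \<le> 0}"] by auto
  then have D\<D>: "D \<in> \<D>" by (simp add: \<D> weak_nodal_domains_def)
  have \<alpha>D: "\<alpha> D \<noteq> 0" by (rule u[OF D\<D> D(2)])
  have xv0: "0 \<le> x $ v" using component_subset[OF C(1)] v by auto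
  have xv: "x $ v = 0"
  proof (rule ccontr)
    assume "x $ v \<noteq> 0"
    then have xv: "0 < x $ v" using xv0 by simp
    obtain e where e: "e \<in> E" "\<And>S. v \<in> S \<Longrightarrow> u \<notin> S \<Longrightarrow> 0 < cut e S" "\<And>S. u \<in> S \<Longrightarrow> v \<notin> S \<Longrightarrow> 0 < cut e S"
      using adjacency_cut_pos[OF adj] by blast
    have "lovasz_ext w e (restr x C) \<noteq> 0"
    proof
      assume "lovasz_ext w e (restr x C) = 0"
      then have "cut e {b. 0 < restr x C $ b} = 0" by (rule lovasz_zero_cut[OF e(1)])
      moreover have "0 < cut e {b. 0 < restr x C $ b}"
        by (rule e(2)) (use v xu xv in simp_all)
      ultimately show False by (simp only: less_irrefl)
    qed
    moreover have "lovasz_ext w e (restr x D) \<noteq> 0"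
    proof
      assume "lovasz_ext w e (restr x D) = 0"
      then have "lovasz_ext w e (- restr x D) = 0" by (simp add: lovasz_uminus[OF e(1)])
      then have "cut e {b. 0 < (- restr x D) $ b} = 0" by (rule lovasz_zero_cut[OF e(1)])
      moreover have "0 < cut e {b. 0 < (- restr x D) $ b}"
        by (rule e(3)) (use D(2) xu xv in simp_all)
      ultimately show False by (simp only: less_irrefl)
    qed
    ultimately have "\<bar>\<alpha> C\<bar> = \<bar>\<alpha> D\<bar>"
      using lovasz_nonneg[OF e(1), of "restr x C"] lovasz_nonneg[OF e(1), of "restr x D"]
      by (intro energy_comb(2)[OF x F eq[unfolded y_def] e(1) C\<D> D\<D>]) auto
    then show False using C(2) \<alpha>D by simp
  qed
  have vD: "v \<in> D"
    using component_closed'[OF D _ adj] xv by simp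
  have yu: "y $ u = \<alpha> D * x $ u" unfolding y_def by (rule comb_nth[OF F D\<D> D(2)])
  show ?thesis
  proof (cases "0 < y $ u")
    case True
    show ?thesis by (rule energy_descent_oriented[OF x \<D> y_def eq C D(1) v vD D(2) xu True adj])
  next
    case False
    then have pos: "0 < (- y) $ u" using yu \<alpha>D xu by (simp add: less_le)
    have ny: "- y = comb x \<D> (\<lambda>D. - \<alpha> D)" by (simp add: y_def comb_uminus)
    have eq': "energy (- y) = l * mass (- y)" using eq by (simp add: energy_uminus)
    have \<alpha>C: "- \<alpha> C = 0" by (simp add: C(2))
    have "\<exists>z. energy z < energy (- y) \<and> pairing (- y) z = mass (- y)"
      by (rule energy_descent_oriented[OF x \<D> ny eq' C(1) \<alpha>C D(1) v vD D(2) xu pos adj])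
    then obtain z where z: "energy z < energy (- y)" "pairing (- y) z = mass (- y)" by blast
    have "energy (- z) < energy y" using z(1) by (simp only: energy_uminus)
    moreover have "pairing y (- z) = mass y" using z(2) by (simp add: phi_uminus sum_negf)
    ultimately show ?thesis by blast
  qed
qed

lemma energy_descent:
  assumes x: "eigenpair E \<theta> w \<mu> p l x" and \<D>: "\<D> = weak_nodal_domains E w x"
    and y_def: "y = comb x \<D> \<alpha>" and eq: "energy y = l * mass y" and "y \<noteq> 0"
    and D0: "D0 \<in> \<D>" "\<alpha> D0 = 0"
  shows "\<exists>z. energy z < energy y \<and> pairing y z = mass y"
proof -
  have F: "nodal_family x \<D>" unfolding \<D> by (rule nodal_family_weak[OF x])
  \<comment> \<open>The switched-off domains miss the support of \<open>y\<close>, so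
    \<open>R\<close> is a proper nonempty set and connectedness gives an adjacency leaving
    it.\<close>
  define R where "R = \<Union>{D \<in> \<D>. \<alpha> D = 0}"
  obtain b where b: "y $ b \<noteq> 0" using \<open>y \<noteq> 0\<close> by (auto simp: vec_eq_iff)
  have "b \<notin> R"
  proof
    assume "b \<in> R"
    then obtain D where "D \<in> \<D>" "b \<in> D" "\<alpha> D = 0" by (auto simp: R_def)
    then show False using b comb_nth[OF F, of D b \<alpha>] by (simp add: y_def)
  qed
  have "D0 \<noteq> {}"
    using D0(1) component_nonempty unfolding \<D> weak_nodal_domains_def by blast
  then have "R \<noteq> {}" using D0 by (auto simp: R_def)
  then obtain v u where vu: "v \<in> R" "(v, u) \<in> adjacency E w" "u \<notin> R"
    using closed_under_adjacency[of R] \<open>b \<notin> R\<close> by blast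
  then obtain C where C: "C \<in> \<D>" "v \<in> C" "\<alpha> C = 0" by (auto simp: R_def)
  have u: "\<alpha> D \<noteq> 0" if "D \<in> \<D>" "u \<in> D" for D
    using vu(3) that by (auto simp: R_def)
  show ?thesis
  proof (cases "C \<in> conn_components E w {v. 0 \<le> x $ v}")
    case True
    show ?thesis by (rule energy_descent_half[OF x \<D> y_def eq True C(3,2) vu(2) u])
  next
    case False
    then have C': "C \<in> conn_components E w {v. 0 \<le> (- x) $ v}"
      using C(1) by (auto simp: \<D> weak_nodal_domains_def)
    have \<D>': "\<D> = weak_nodal_domains E w (- x)" by (simp add: \<D> weak_nodal_domains_uminus)
    have y': "y = comb (- x) \<D> (\<lambda>D. - \<alpha> D)" by (simp add: y_def comb_uminus comb_uminus_left)
    have \<alpha>C: "- \<alpha> C = 0" by (simp add: C(3))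
    have nu: "- \<alpha> D \<noteq> 0" if "D \<in> \<D>" "u \<in> D" for D using u[OF that] by simp
    show ?thesis
      by (rule energy_descent_half[OF eigenpair_uminus[OF x] \<D>' y' eq C' \<alpha>C C(2) vu(2) nu])
  qed
qed

end

section \<open>Genus and variational eigenvalues\<close>

lemma genus_mono:
  fixes A :: "'a::real_normed_vector set" and B :: "'b::real_normed_vector set"
  assumes h: "continuous_on A h" "h ` A \<subseteq> B" and odd: "\<And>x. x \<in> A \<Longrightarrow> h (- x) = - h x"
  shows "genus A \<le> genus B"
proof (cases "A = {}")
  case False
  then have "B \<noteq> {}" using h(2) by blast
  have "odd_map_exists A k" if B: "odd_map_exists B k" for k
  proof -
    obtain g where g: "continuous_map (top_of_set B) (subtopology (Euclidean_space k) (- {\<lambda>i. 0})) g"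
      and g_odd: "\<And>x. x \<in> B \<Longrightarrow> g (- x) = (\<lambda>i. - g x i)"
      using B unfolding odd_map_exists_def by blast
    have "continuous_map (top_of_set A) (top_of_set B) h"
      using h by (simp add: image_subset_iff_funcset)
    from continuous_map_compose[OF this g] show ?thesis
      unfolding odd_map_exists_def using g_odd odd h(2) by (intro exI[of _ "g \<circ> h"]) auto
  qed
  then show ?thesis
    using False \<open>B \<noteq> {}\<close> unfolding genus_def by (auto intro!: INF_superset_mono)
qed (simp add: genus_def)

context connected_submodular_hypergraph
begin

section \<open>Continuity, convexity and normalization\<close>

lemma continuous_on_energy: "continuous_on S energy"
  unfolding Q_form_def using lovasz_nonneg p_gt_1
  by (intro continuous_on_sum continuous_on_mult continuous_on_const continuous_on_powr' continuous_on_lovasz) auto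

lemma continuous_on_mass: "continuous_on S mass"
  using p_gt_1
  by (intro continuous_on_sum continuous_on_mult continuous_on_const continuous_on_powr' continuous_intros) auto

lemma continuous_on_phi_nth: "continuous_on S (\<lambda>y :: real ^ 'n. phi p y $ v)"
proof -
  \<comment> \<open>Splitting into positive and negative parts removes the discontinuous
    \<open>sgn\<close>.\<close>
  have "phi p y $ v = max (y $ v) 0 powr (p - 1) - max (- (y $ v)) 0 powr (p - 1)" for y :: "real ^ 'n"
    by (auto simp: phi_def sgn_if max_def)
  moreover have "continuous_on S (\<lambda>y :: real ^ 'n. max (y $ v) 0 powr (p - 1) - max (- (y $ v)) 0 powr (p - 1))"
    using p_gt_1 by (intro continuous_on_diff continuous_on_powr' continuous_intros) auto
  ultimately show ?thesis by simp
qed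

lemma energy_convex_combination:
  assumes I: "finite I" and a: "\<And>i. i \<in> I \<Longrightarrow> 0 \<le> a i" "sum a I = 1"
  shows "energy (\<Sum>i\<in>I. a i *\<^sub>R z i) \<le> (\<Sum>i\<in>I. a i * energy (z i))"
proof -
  have "\<theta> e * lovasz_ext w e (\<Sum>i\<in>I. a i *\<^sub>R z i) powr p \<le> (\<Sum>i\<in>I. a i * (\<theta> e * lovasz_ext w e (z i) powr p))"
    if e: "e \<in> E" for e
  proof -
    have "lovasz_ext w e (\<Sum>i\<in>I. a i *\<^sub>R z i) \<le> (\<Sum>i\<in>I. lovasz_ext w e (z i) * a i)"
      using lovasz_sum_le[OF e I, of "\<lambda>i. a i *\<^sub>R z i"] a(1)
      by (simp add: lovasz_scaleR[OF e] mult.commute cong: sum.cong)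
    then have "lovasz_ext w e (\<Sum>i\<in>I. a i *\<^sub>R z i) powr p \<le> (\<Sum>i\<in>I. lovasz_ext w e (z i) * a i) powr p"
      using lovasz_nonneg[OF e] p_gt_1 by (intro powr_mono2) auto
    also have "\<dots> \<le> (\<Sum>i\<in>I. lovasz_ext w e (z i) powr p * a i)"
      using weighted_power_mean(1)[OF p_gt_1 I, of a "\<lambda>i. lovasz_ext w e (z i)"] a lovasz_nonneg[OF e] by simp
    finally have "\<theta> e * lovasz_ext w e (\<Sum>i\<in>I. a i *\<^sub>R z i) powr p
        \<le> \<theta> e * (\<Sum>i\<in>I. lovasz_ext w e (z i) powr p * a i)"
      using scale_nonneg[OF e] by (rule mult_left_mono)
    then show ?thesis by (simp add: sum_distrib_left mult_ac)
  qed
  then have "energy (\<Sum>i\<in>I. a i *\<^sub>R z i) \<le> (\<Sum>e\<in>E. \<Sum>i\<in>I. a i * (\<theta> e * lovasz_ext w e (z i) powr p))"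
    unfolding Q_form_def by (rule sum_mono)
  also have "\<dots> = (\<Sum>i\<in>I. a i * energy (z i))"
    unfolding Q_form_def sum_distrib_left by (rule sum.swap)
  finally show ?thesis .
qed

text \<open>Since \<open>pairing y y = mass y\<close>, the left side is the tangent of the convex
  function \<open>mass\<close> at \<open>y\<close>, evaluated at \<open>z\<close>.\<close>

lemma pairing_Young: "p * pairing y z - (p - 1) * mass y \<le> mass z"
proof -
  have "p * (\<mu> v * phi p y $ v * z $ v) - (p - 1) * (\<mu> v * \<bar>y $ v\<bar> powr p) \<le> \<mu> v * \<bar>z $ v\<bar> powr p" for v
  proof -
    have "\<bar>y $ v\<bar> powr p + p * \<bar>y $ v\<bar> powr (p - 1) * (\<bar>z $ v\<bar> - \<bar>y $ v\<bar>) \<le> \<bar>z $ v\<bar> powr p"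
      using powr_above_tangent(1)[OF p_gt_1] by simp
    moreover have "\<bar>y $ v\<bar> * \<bar>y $ v\<bar> powr (p - 1) = \<bar>y $ v\<bar> powr p"
      by (simp add: powr_mult_base)
    moreover have "p * (phi p y $ v * z $ v) \<le> p * (\<bar>y $ v\<bar> powr (p - 1) * \<bar>z $ v\<bar>)"
      using phi_nth_mult_le p_gt_1 by (intro mult_left_mono) auto
    ultimately have "p * (phi p y $ v * z $ v) - (p - 1) * \<bar>y $ v\<bar> powr p \<le> \<bar>z $ v\<bar> powr p"
      by (simp add: algebra_simps)
    from mult_left_mono[OF this weight_nonneg[of v]] show ?thesis by (simp add: algebra_simps)
  qed
  then have "(\<Sum>v\<in>UNIV. p * (\<mu> v * phi p y $ v * z $ v) - (p - 1) * (\<mu> v * \<bar>y $ v\<bar> powr p)) \<le> mass z"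
    by (rule sum_mono)
  then show ?thesis by (simp add: sum_subtractf sum_distrib_left)
qed

definition normalize_mass :: "real ^ 'n \<Rightarrow> real ^ 'n" where
  "normalize_mass z = (mass z powr (- 1 / p)) *\<^sub>R z"

lemma mass_normalize:
  assumes "z \<noteq> 0"
  shows "mass (normalize_mass z) = 1"
proof -
  have "mass (normalize_mass z) = (mass z powr (- 1 / p)) powr p * mass z"
    unfolding normalize_mass_def mass_scaleR by simp
  also have "(mass z powr (- 1 / p)) powr p = mass z powr (- 1)"
    unfolding powr_powr using p_gt_1 by simp
  also have "mass z powr (- 1) * mass z = 1"
    using mass_pos[OF assms] by (simp add: powr_neg_one)
  finally show ?thesis .
qed

lemma normalize_mass_uminus: "normalize_mass (- z) = - normalize_mass z"
  by (simp add: normalize_mass_def)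

lemma continuous_on_normalize:
  assumes "continuous_on S h" "\<And>x. x \<in> S \<Longrightarrow> h x \<noteq> 0"
  shows "continuous_on S (\<lambda>x. normalize_mass (h x))"
proof -
  have "continuous_on S (\<lambda>x. mass (h x))"
    by (rule continuous_on_compose2[OF continuous_on_mass[of UNIV] assms(1)]) simp
  moreover have "mass (h x) \<noteq> 0" if "x \<in> S" for x
    using mass_pos[OF assms(2)[OF that]] by simp
  ultimately show ?thesis
    unfolding normalize_mass_def
    by (intro continuous_on_scaleR continuous_on_powr assms(1) continuous_on_const) auto
qed

lemma in_p_sphere: "x \<in> p_sphere \<mu> p \<longleftrightarrow> mass x = 1"
  by (simp add: p_sphere_def)

lemma compact_p_sphere: "compact (p_sphere \<mu> p)"
proof -
  have "closed (p_sphere \<mu> p)"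
    unfolding p_sphere_def by (intro closed_Collect_eq continuous_on_mass continuous_on_const)
  moreover have "bounded (p_sphere \<mu> p)"
  proof (rule boundedI)
    fix z assume z: "z \<in> p_sphere \<mu> p"
    have "\<bar>z $ v\<bar> \<le> (1 / \<mu> v) powr (1 / p)" for v
    proof -
      have "\<mu> v * \<bar>z $ v\<bar> powr p \<le> mass z"
        using weight_nonneg by (intro member_le_sum) auto
      then have "\<bar>z $ v\<bar> powr p \<le> 1 / \<mu> v"
        using z vertex_weight_pos[of v] by (simp add: in_p_sphere field_simps)
      then have "(\<bar>z $ v\<bar> powr p) powr (1 / p) \<le> (1 / \<mu> v) powr (1 / p)"
        using p_gt_1 by (intro powr_mono2) auto
      then show ?thesis using p_gt_1 by (simp add: powr_powr)
    qed
    then have "(\<Sum>v\<in>UNIV. \<bar>z $ v\<bar>) \<le> (\<Sum>v\<in>UNIV. (1 / \<mu> v) powr (1 / p))" by (rule sum_mono)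
    then show "norm z \<le> (\<Sum>v\<in>UNIV. (1 / \<mu> v) powr (1 / p))"
      using norm_le_l1_cart[of z] by simp
  qed
  ultimately show ?thesis by (simp add: compact_eq_bounded_closed)
qed

lemma genus_family_compact: "A \<in> genus_family \<mu> p k \<Longrightarrow> compact A"
  using compact_Int_closed[OF compact_p_sphere, of A] by (auto simp: genus_family_def Int_absorb1)

lemma genus_family_nonempty:
  assumes "k \<ge> 1" "A \<in> genus_family \<mu> p k"
  shows "A \<noteq> {}"
proof
  assume "A = {}"
  then have "enat k \<le> 0" using assms(2) by (simp add: genus_family_def genus_def)
  then show False using assms(1) by (simp add: zero_enat_def)
qed

lemma genus_family_energy_max:
  assumes "k \<ge> 1" "A \<in> genus_family \<mu> p k"
  obtains x where "x \<in> A" "(SUP x\<in>A. energy x) = energy x"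
proof -
  obtain x where "x \<in> A" "\<And>y. y \<in> A \<Longrightarrow> energy y \<le> energy x"
    using continuous_attains_sup[OF genus_family_compact[OF assms(2)] genus_family_nonempty[OF assms]
        continuous_on_energy] by blast
  moreover from this have "(SUP x\<in>A. energy x) = energy x"
    by (intro cSup_eq_maximum) auto
  ultimately show thesis using that by blast
qed

lemma var_eigenvalue_le:
  assumes k: "k \<ge> 1" and A: "A \<in> genus_family \<mu> p k"
  obtains x where "x \<in> A" "var_eigenvalue E \<theta> w \<mu> p k \<le> energy x"
proof -
  obtain x where x: "x \<in> A" "(SUP x\<in>A. energy x) = energy x"
    using genus_family_energy_max[OF k A] by blast
  have "bdd_below ((\<lambda>A. SUP x\<in>A. energy x) ` genus_family \<mu> p k)"
  proof (rule bdd_belowI2[where m = 0])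
    fix B assume "B \<in> genus_family \<mu> p k"
    then show "0 \<le> (SUP x\<in>B. energy x)"
      using genus_family_energy_max[OF k] energy_nonneg by metis
  qed
  then have "var_eigenvalue E \<theta> w \<mu> p k \<le> (SUP x\<in>A. energy x)"
    unfolding var_eigenvalue_def by (rule cINF_lower[OF _ A])
  then show thesis using that x by simp
qed

text \<open>
  Subtracting from the energy the linearization of \<open>l * mass\<close> at \<open>y\<close> gives a function that is convex
  in \<open>z\<close> and, by Young's inequality, dominates \<open>energy z - l * mass z\<close>.  Convexity makes its negative
  sets stable under partitions of unity.
\<close>

definition majorant :: "real \<Rightarrow> real ^ 'n \<Rightarrow> real ^ 'n \<Rightarrow> real" where
  "majorant l y z = energy z - l * (p * pairing y z - (p - 1) * mass y)"

lemma majorant_ge: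
  assumes "0 \<le> l"
  shows "energy z - l * mass z \<le> majorant l y z"
  using mult_left_mono[OF pairing_Young[of y z] assms] by (simp add: majorant_def)

lemma continuous_on_majorant: "continuous_on S (\<lambda>y. majorant l y z)"
  unfolding majorant_def
  by (intro continuous_intros continuous_on_mass continuous_on_phi_nth)

lemma majorant_uminus: "majorant l (- y) (- z) = majorant l y z"
  by (simp add: majorant_def energy_uminus phi_uminus)

lemma majorant_convex_combination:
  assumes I: "finite I" and a: "\<And>i. i \<in> I \<Longrightarrow> 0 \<le> a i" "sum a I = 1"
  shows "majorant l y (\<Sum>i\<in>I. a i *\<^sub>R z i) \<le> (\<Sum>i\<in>I. a i * majorant l y (z i))"
proof -
  have "pairing y (\<Sum>i\<in>I. a i *\<^sub>R z i) = (\<Sum>i\<in>I. a i * pairing y (z i))"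
    unfolding sum_component scaleR_vec_def vec_lambda_beta sum_distrib_left real_scaleR_def
    by (subst sum.swap) (simp add: mult_ac)
  moreover have "(\<Sum>i\<in>I. a i * majorant l y (z i)) = (\<Sum>i\<in>I. a i * energy (z i))
      - l * (p * (\<Sum>i\<in>I. a i * pairing y (z i)) - (p - 1) * mass y * sum a I)"
  proof -
    have *: "b * (g - l * (p * q - m)) = b * g - l * (p * (b * q)) + l * m * b" for b g q m :: real
      by (simp add: algebra_simps)
    show ?thesis
      unfolding majorant_def *
      by (simp add: sum.distrib sum_subtractf algebra_simps flip: sum_distrib_left sum_distrib_right)
  qed
  ultimately show ?thesis
    using energy_convex_combination[OF I a, of z] a(2) by (simp add: majorant_def)
qed

text \<open>For fixed \<open>z\<close> the condition on \<open>y\<close> is open, so finitely many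
  points \<open>z\<close> serve all of the compact set \<open>A\<close>. Averaging them gives an odd
  map; its normalized image has genus at least \<open>k\<close> and energy below \<open>l\<close>
  everywhere.\<close>

lemma var_eigenvalue_less:
  assumes k: "k \<ge> 1" and l: "0 \<le> l" and A: "A \<in> genus_family \<mu> p k"
    and ex: "\<And>y. y \<in> A \<Longrightarrow> \<exists>z. majorant l y z < 0"
  shows "var_eigenvalue E \<theta> w \<mu> p k < l"
proof -
  define V where "V z = {y. majorant l y z < 0}" for z
  have cover: "A \<subseteq> (\<Union>z\<in>UNIV. V z)" using ex by (auto simp: V_def)
  have V_open: "open (V z)" for z
    unfolding V_def by (intro open_Collect_less continuous_on_majorant continuous_on_const)
  obtain Z0 where "Z0 \<subseteq> UNIV" and Z0: "finite Z0" "A \<subseteq> (\<Union>z\<in>Z0. V z)"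
    by (rule compactE_image[OF genus_family_compact[OF A] V_open cover])
  \<comment> \<open>Symmetrized because the majorant is invariant under negating both arguments;
    this makes \<open>h\<close> odd.\<close>
  define Z where "Z = Z0 \<union> uminus ` Z0"
  have Z: "finite Z" "uminus ` Z = Z" using Z0(1) by (auto simp: Z_def image_Un image_image)
  \<comment> \<open>Only points with negative majorant receive weight. The weights stay
    unnormalized, since energy and mass are homogeneous of the same degree and their comparison
    survives rescaling.\<close>
  define c where "c y z = max 0 (- majorant l y z)" for y z
  define h where "h y = (\<Sum>z\<in>Z. c y z *\<^sub>R z)" for y
  have A_neg: "- y \<in> A" if "y \<in> A" for y using A that by (auto simp: genus_family_def)
  have h_neg: "h (- y) = - h y" for y
  proof -
    have "h (- y) = (\<Sum>z\<in>uminus ` Z. c (- y) z *\<^sub>R z)" by (simp add: h_def Z)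
    also have "\<dots> = (\<Sum>z\<in>Z. c (- y) (- z) *\<^sub>R (- z))" by (subst sum.reindex) auto
    also have "\<dots> = - h y" by (simp add: h_def c_def majorant_uminus sum_negf)
    finally show ?thesis .
  qed
  have h_less: "energy (h y) < l * mass (h y)" if y: "y \<in> A" for y
  proof -
    define s where "s = (\<Sum>z\<in>Z. c y z)"
    obtain z0 where z0: "z0 \<in> Z" "majorant l y z0 < 0" using y Z0(2) by (auto simp: Z_def V_def)
    have s0: "0 < s" unfolding s_def using z0 Z(1) by (intro sum_pos2[of Z z0]) (auto simp: c_def)
    have "h y = s *\<^sub>R (\<Sum>z\<in>Z. (c y z / s) *\<^sub>R z)" (is "_ = s *\<^sub>R ?g")
      using s0 by (simp add: h_def scaleR_sum_right)
    have "majorant l y ?g \<le> (\<Sum>z\<in>Z. c y z / s * majorant l y z)"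
      using s0 by (intro majorant_convex_combination[OF Z(1)])
        (auto simp: c_def s_def simp flip: sum_divide_distrib)
    also have "\<dots> < 0"
    proof -
      have "0 < (\<Sum>z\<in>Z. - (c y z / s * majorant l y z))"
      proof (rule sum_pos2[OF Z(1) z0(1)])
        show "0 < - (c y z0 / s * majorant l y z0)"
          using z0(2) s0 by (simp add: c_def mult_neg_neg)
        show "0 \<le> - (c y z / s * majorant l y z)" for z
          using s0 by (simp add: c_def max_def mult_nonneg_nonpos)
      qed
      then show ?thesis by (simp add: sum_negf)
    qed
    finally have "energy ?g < l * mass ?g" using majorant_ge[OF l, of ?g y] by simp
    then have "s powr p * energy ?g < s powr p * (l * mass ?g)" using s0 by simp
    then show ?thesis
      unfolding \<open>h y = s *\<^sub>R ?g\<close> energy_scaleR mass_scaleR using s0 by (simp only: abs_of_pos mult.left_commute)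
  qed
  have h0: "h y \<noteq> 0" if "y \<in> A" for y
  proof
    assume "h y = 0"
    then show False using h_less[OF that] energy_nonneg[of "h y"] p_gt_1 by simp
  qed
  have "continuous_on A (\<lambda>y. c y z)" for z
    unfolding c_def by (intro continuous_intros continuous_on_majorant)
  then have "continuous_on A h" unfolding h_def by (intro continuous_intros)
  then have n: "continuous_on A (\<lambda>y. normalize_mass (h y))" by (rule continuous_on_normalize[OF _ h0])
  define B where "B = (\<lambda>y. normalize_mass (h y)) ` A"
  have "B \<in> genus_family \<mu> p k"
    unfolding genus_family_def
  proof (intro CollectI conjI)
    show "B \<subseteq> p_sphere \<mu> p" using mass_normalize[OF h0] by (auto simp: B_def in_p_sphere)
    have *: "- normalize_mass (h y) = normalize_mass (h (- y))" for y by (simp add: h_neg normalize_mass_uminus)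
    have sub: "uminus ` B \<subseteq> B" using A_neg by (auto simp: B_def *)
    then have "uminus ` (uminus ` B) \<subseteq> uminus ` B" by (rule image_mono)
    then show "uminus ` B = B" using sub by (simp add: image_image)
    show "closed B" unfolding B_def
      by (intro compact_imp_closed compact_continuous_image n genus_family_compact[OF A])
    have "genus A \<le> genus B"
      by (rule genus_mono[OF n]) (simp_all add: B_def h_neg normalize_mass_uminus)
    then show "enat k \<le> genus B" using A by (auto simp: genus_family_def)
  qed
  then obtain b where b: "b \<in> B" "var_eigenvalue E \<theta> w \<mu> p k \<le> energy b"
    using var_eigenvalue_le[OF k] by blast
  then obtain y where y: "y \<in> A" "b = normalize_mass (h y)" by (auto simp: B_def)
  define a where "a = mass (h y) powr (- 1 / p)"
  have "0 < a" using mass_pos[OF h0[OF y(1)]] by (simp add: a_def)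
  then have "a powr p * energy (h y) < a powr p * (l * mass (h y))" using h_less[OF y(1)] by simp
  then have "energy b < l * mass b"
    using \<open>0 < a\<close> unfolding y(2) normalize_mass_def a_def[symmetric] energy_scaleR mass_scaleR
    by (simp only: abs_of_pos mult.left_commute)
  then show ?thesis using b(2) mass_normalize[OF h0[OF y(1)]] by (simp add: y(2))
qed


section \<open>Spheres of combinations and the two counts\<close>

definition comb_sphere :: "real ^ 'n \<Rightarrow> 'n set set \<Rightarrow> 'n set set \<Rightarrow> (real ^ 'n) set" where
  "comb_sphere x \<D> \<K> = {y. \<exists>\<alpha>. y = comb x \<D> \<alpha> \<and> (\<forall>D\<in>\<D> - \<K>. \<alpha> D = 0)} \<inter> p_sphere \<mu> p"

lemma comb_sphereE:
  assumes "y \<in> comb_sphere x \<D> \<K>"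
  obtains \<alpha> where "y = comb x \<D> \<alpha>" "\<And>D. D \<in> \<D> - \<K> \<Longrightarrow> \<alpha> D = 0" "mass y = 1"
  using assms by (auto simp: comb_sphere_def in_p_sphere)

text \<open>Choosing a support vertex in each domain is injective, as domains overlap only at zeros.
  The bound provides enough dimensions for the Borsuk--Ulam theorem.\<close>

lemma card_nodal_le:
  assumes F: "nodal_family x \<D>"
  shows "card \<D> \<le> CARD('n)"
proof -
  have "\<exists>v\<in>D. x $ v \<noteq> 0" if "D \<in> \<D>" for D
  proof (rule ccontr)
    assume "\<not> ?thesis"
    then have "restr x D = 0" by (simp add: vec_eq_iff)
    then show False using F that by (simp add: nodal_family_def)
  qed
  then obtain g where g: "\<And>D. D \<in> \<D> \<Longrightarrow> g D \<in> D \<and> x $ g D \<noteq> 0" by metis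
  have "inj_on g \<D>"
  proof (rule inj_onI)
    fix D D' assume D: "D \<in> \<D>" "D' \<in> \<D>" "g D = g D'"
    then have "g D \<in> D" "g D \<in> D'" "x $ g D \<noteq> 0" using g[OF D(1)] g[OF D(2)] by auto
    then show "D = D'" using F D(1,2) unfolding nodal_family_def by blast
  qed
  then show ?thesis by (rule card_inj_on_le) auto
qed

text \<open>The coefficient sphere maps oddly into the set, and a support vertex of a domain with
  nonzero coefficient shows that no combination vanishes. The combinations run over all of
  \<open>\<D>\<close>, with coefficient 0 outside \<open>\<K>\<close>, because
  \<open>energy_comb\<close> is about a family covering the support of \<open>x\<close>.\<close>

lemma comb_sphere_genus_family:
  assumes F: "nodal_family x \<D>" and \<K>: "\<K> \<subseteq> \<D>" and m: "card \<K> = m" "m \<ge> 1"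
  shows "comb_sphere x \<D> \<K> \<in> genus_family \<mu> p m"
  unfolding genus_family_def
proof (intro CollectI conjI)
  let ?A = "comb_sphere x \<D> \<K>"
  define L where "L = {y. \<exists>\<alpha>. y = comb x \<D> \<alpha> \<and> (\<forall>D\<in>\<D> - \<K>. \<alpha> D = 0)}"
  have A: "?A = L \<inter> p_sphere \<mu> p" by (simp add: comb_sphere_def L_def)
  have "subspace L"
    unfolding subspace_def
  proof (intro conjI ballI allI)
    show "0 \<in> L" by (auto simp: L_def comb_def intro!: exI[of _ "\<lambda>_. 0"])
    fix y z :: "real ^ 'n" and c :: real assume y: "y \<in> L"
    then obtain \<alpha> where \<alpha>: "y = comb x \<D> \<alpha>" "\<forall>D\<in>\<D> - \<K>. \<alpha> D = 0" by (auto simp: L_def)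
    have "c *\<^sub>R y = comb x \<D> (\<lambda>D. c * \<alpha> D)" by (simp add: \<alpha>(1) comb_def scaleR_sum_right)
    then show "c *\<^sub>R y \<in> L" using \<alpha>(2) by (auto simp: L_def)
    assume "z \<in> L"
    then obtain \<beta> where \<beta>: "z = comb x \<D> \<beta>" "\<forall>D\<in>\<D> - \<K>. \<beta> D = 0" by (auto simp: L_def)
    have "y + z = comb x \<D> (\<lambda>D. \<alpha> D + \<beta> D)" by (simp add: \<alpha>(1) \<beta>(1) comb_def sum.distrib scaleR_add_left)
    then show "y + z \<in> L" using \<alpha>(2) \<beta>(2) by (auto simp: L_def)
  qed
  show "?A \<subseteq> p_sphere \<mu> p" by (simp add: A)
  show "closed ?A"
    unfolding A using closed_subspace[OF \<open>subspace L\<close>] compact_imp_closed[OF compact_p_sphere] by (rule closed_Int)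
  have neg: "- y \<in> ?A" if "y \<in> ?A" for y
    using that subspace_neg[OF \<open>subspace L\<close>] by (auto simp: A in_p_sphere)
  then have sub: "uminus ` ?A \<subseteq> ?A" by blast
  then have "uminus ` (uminus ` ?A) \<subseteq> uminus ` ?A" by (rule image_mono)
  then show "uminus ` ?A = ?A" using sub by (simp add: image_image)
  obtain g where "bij_betw g \<K> {0..<card \<K>}"
    using ex_bij_betw_finite_nat[OF finite] by blast
  then have g: "bij_betw g \<K> {..<m}" by (simp add: m(1) atLeast0LessThan)
  define \<alpha> where "\<alpha> a D = (if D \<in> \<K> then a (g D) else 0)" for a :: "nat \<Rightarrow> real" and D
  let ?S = "topspace (nsphere (m - 1))"
  have nz: "comb x \<D> (\<alpha> a) \<noteq> 0" if a: "a \<in> ?S" for a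
  proof -
    have "\<exists>i\<le>m - 1. a i \<noteq> 0"
    proof (rule ccontr)
      assume "\<not> ?thesis"
      then have "(\<Sum>i\<le>m - 1. (a i)\<^sup>2) = 0" by simp
      then show False using a by (simp add: topspace_nsphere)
    qed
    then obtain i where "i \<le> m - 1" "a i \<noteq> 0" by blast
    then have i: "i \<in> {..<m}" "a i \<noteq> 0" using m(2) by simp_all
    have "i \<in> g ` \<K>" using i(1) bij_betw_imp_surj_on[OF g] by simp
    then obtain D where D: "D \<in> \<K>" "g D = i" by blast
    then have D\<D>: "D \<in> \<D>" using \<K> by blast
    then have "restr x D \<noteq> 0" using F by (simp add: nodal_family_def)
    then obtain v where "restr x D $ v \<noteq> 0" by (auto simp: vec_eq_iff)
    then have v: "v \<in> D" "x $ v \<noteq> 0" by (auto split: if_splits)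
    have "comb x \<D> (\<alpha> a) $ v = a i * x $ v" using comb_nth[OF F D\<D> v(1)] D by (simp add: \<alpha>_def)
    then have "comb x \<D> (\<alpha> a) $ v \<noteq> 0" using i v by simp
    then show ?thesis by (metis zero_index)
  qed
  have cont: "continuous_on ?S (\<lambda>a. \<alpha> a D)" for D
    unfolding \<alpha>_def
    by (cases "D \<in> \<K>") (auto intro: continuous_on_subset[OF continuous_on_product_coordinates])
  have "continuous_on ?S (\<lambda>a. comb x \<D> (\<alpha> a))"
    unfolding comb_def by (intro continuous_intros cont)
  then have contn: "continuous_on ?S (\<lambda>a. normalize_mass (comb x \<D> (\<alpha> a)))"
    by (rule continuous_on_normalize[OF _ nz])
  have into: "normalize_mass (comb x \<D> (\<alpha> a)) \<in> ?A" if a: "a \<in> ?S" for a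
  proof -
    have "comb x \<D> (\<alpha> a) \<in> L" by (auto simp: L_def \<alpha>_def)
    then have "normalize_mass (comb x \<D> (\<alpha> a)) \<in> L"
      unfolding normalize_mass_def by (rule subspace_scale[OF \<open>subspace L\<close>])
    then show ?thesis using mass_normalize[OF nz[OF a]] by (simp add: A in_p_sphere)
  qed
  have odd: "normalize_mass (comb x \<D> (\<alpha> (\<lambda>i. - a i))) = - normalize_mass (comb x \<D> (\<alpha> a))" for a
  proof -
    have "\<alpha> (\<lambda>i. - a i) = (\<lambda>D. - \<alpha> a D)" by (simp add: \<alpha>_def fun_eq_iff)
    then show ?thesis by (simp add: comb_uminus normalize_mass_uminus)
  qed
  have "m \<le> DIM(real ^ 'n)"
    using card_mono[OF finite \<K>] card_nodal_le[OF F] m(1) by simp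
  then show "enat m \<le> genus ?A"
    by (rule Borsuk_Ulam_genus[OF m(2) _ contn]) (use into odd in auto)
qed

text \<open>Applied with \<open>k + r\<close> in place of \<open>k\<close>. The gap is assumed only
  for indices up to \<open>CARD('n)\<close>; a family of \<open>k\<close> domains, if present,
  forces \<open>k\<close> into that range.\<close>

lemma card_strong_nodal_domains_le:
  assumes x: "eigenpair E \<theta> w \<mu> p l x"
    and less: "k \<le> CARD('n) \<Longrightarrow> l < var_eigenvalue E \<theta> w \<mu> p k" and k: "k \<ge> 1"
  shows "card (strong_nodal_domains E w x) < k"
proof (rule ccontr)
  let ?\<D> = "strong_nodal_domains E w x"
  assume "\<not> ?thesis"
  then have "k \<le> card ?\<D>" by simp
  then obtain \<K> where \<K>: "\<K> \<subseteq> ?\<D>" "card \<K> = k" by (metis obtain_subset_with_card_n)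
  note F = nodal_family_strong[of x]
  obtain y where y: "y \<in> comb_sphere x ?\<D> \<K>" "var_eigenvalue E \<theta> w \<mu> p k \<le> energy y"
    using var_eigenvalue_le[OF k comb_sphere_genus_family[OF F \<K> k]] by blast
  obtain \<alpha> where "y = comb x ?\<D> \<alpha>" "mass y = 1" using comb_sphereE[OF y(1)] by blast
  then have "energy y \<le> l" using energy_comb(1)[OF x F, of \<alpha>] by simp
  moreover have "k \<le> CARD('n)" using \<open>k \<le> card ?\<D>\<close> card_nodal_le[OF F] by simp
  ultimately show False using y(2) less by simp
qed

lemma card_weak_nodal_domains_le:
  assumes x: "eigenpair E \<theta> w \<mu> p (var_eigenvalue E \<theta> w \<mu> p k) x" and k: "k \<ge> 1"
  shows "card (weak_nodal_domains E w x) \<le> k"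
proof (rule ccontr)
  let ?\<D> = "weak_nodal_domains E w x" and ?l = "var_eigenvalue E \<theta> w \<mu> p k"
  assume "\<not> ?thesis"
  then have less: "k < card ?\<D>" by simp
  then obtain \<K> where \<K>: "\<K> \<subseteq> ?\<D>" "card \<K> = k" by (metis less_imp_le obtain_subset_with_card_n)
  have "\<K> \<noteq> ?\<D>" using less \<K>(2) by auto
  then obtain D0 where D0: "D0 \<in> ?\<D>" "D0 \<notin> \<K>" using \<K>(1) by blast
  note F = nodal_family_weak[OF x]
  have "\<exists>z. majorant ?l y z < 0" if y: "y \<in> comb_sphere x ?\<D> \<K>" for y
  proof -
    obtain \<alpha> where \<alpha>: "y = comb x ?\<D> \<alpha>" "\<And>D. D \<in> ?\<D> - \<K> \<Longrightarrow> \<alpha> D = 0" and y1: "mass y = 1"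
      using comb_sphereE[OF y] by blast
    have le: "energy y \<le> ?l * mass y" using energy_comb(1)[OF x F, of \<alpha>] by (simp only: \<alpha>(1))
    show ?thesis
    proof (cases "energy y = ?l * mass y")
      case True
      have "y \<noteq> 0" using y1 p_gt_1 by auto
      have "\<alpha> D0 = 0" using \<alpha>(2) D0 by blast
      then obtain z where z: "energy z < energy y" "pairing y z = mass y"
        using energy_descent[OF x refl \<alpha>(1) True \<open>y \<noteq> 0\<close> D0(1)] by blast
      have "majorant ?l y z = energy z - ?l" unfolding majorant_def z(2) y1 by simp
      also have "\<dots> < 0" using z(1) True unfolding y1 by simp
      finally show ?thesis by blast
    next
      case False
      have "majorant ?l y y = energy y - ?l" unfolding majorant_def pairing_self y1 by simp
      also have "\<dots> < 0" using le False unfolding y1 by simp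
      finally show ?thesis by blast
    qed
  qed
  then have "?l < ?l"
    by (rule var_eigenvalue_less[OF k eigenvalue_nonneg[OF x] comb_sphere_genus_family[OF F \<K> k]])
  then show False by simp
qed

end

theorem theorem3p12:
  fixes E :: "'n::finite set set"
    and \<theta> :: "'n set \<Rightarrow> real"
    and w :: "'n set \<Rightarrow> 'n set \<Rightarrow> real"
    and \<mu> :: "'n \<Rightarrow> real"
    and p :: real
    and k r :: nat
    and x :: "real ^ 'n"
  assumes "p > 1"
    and "submodular_hypergraph E \<theta> w \<mu>"
    and "connected_hypergraph E \<theta> w"
    and "k \<ge> 1" and "r \<ge> 1" and "k + r - 1 \<le> CARD('n)"
    and "k > 1 \<Longrightarrow> var_eigenvalue E \<theta> w \<mu> p (k - 1) < var_eigenvalue E \<theta> w \<mu> p k"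
    and "\<forall>i\<in>{k..k + r - 1}. var_eigenvalue E \<theta> w \<mu> p i = var_eigenvalue E \<theta> w \<mu> p k"
    and "k + r \<le> CARD('n) \<Longrightarrow>
           var_eigenvalue E \<theta> w \<mu> p (k + r - 1) < var_eigenvalue E \<theta> w \<mu> p (k + r)"
    and "eigenpair E \<theta> w \<mu> p (var_eigenvalue E \<theta> w \<mu> p k) x"
  shows "card (strong_nodal_domains E w x) \<le> k + r - 1 \<and> card (weak_nodal_domains E w x) \<le> k"
proof -
  have G: "connected_submodular_hypergraph E \<theta> w \<mu> p"
    by (intro connected_submodular_hypergraph.intro connected_submodular_hypergraph_axioms.intro assms(1-3))
  have "k + r - 1 \<in> {k..k + r - 1}" using \<open>r \<ge> 1\<close> by simp
  then have "var_eigenvalue E \<theta> w \<mu> p (k + r - 1) = var_eigenvalue E \<theta> w \<mu> p k"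
    by (rule bspec[OF assms(8)])
  then have less: "var_eigenvalue E \<theta> w \<mu> p k < var_eigenvalue E \<theta> w \<mu> p (k + r)" if "k + r \<le> CARD('n)"
    using assms(9)[OF that] by simp
  have "card (strong_nodal_domains E w x) < k + r"
    by (rule connected_submodular_hypergraph.card_strong_nodal_domains_le[OF G assms(10) less])
      (use \<open>k \<ge> 1\<close> in simp_all)
  moreover have "card (weak_nodal_domains E w x) \<le> k"
    by (rule connected_submodular_hypergraph.card_weak_nodal_domains_le[OF G assms(10) \<open>k \<ge> 1\<close>])
  ultimately show ?thesis by simp
qed

end
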